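(* Let $\mu=(\mu_1\ge\mu_2\ge\dots\ge\mu_r)=(i_1^{m_1},i_2^{m_2},\dots,i_s^{m_s})$ be a partition, where $i_1,\dots,i_s$ are distinct and $i_j$ occurs $m_j$ times. (a) $\mu$ has a stabilising secant degeneracy index if and only if, for some positive integer $m$, there exists a common radical solution of $f_1+f_2+\dots+f_m=0$ with $f_i\in S_\mu$. (b) $\mu$ has a growing secant degeneracy index if and only if, for any form $f\in S_\mu$, the linear span of the $Sym_r$-orbit of $f$ has dimension equal to the multinomial coefficient $\frac{r!}{m_1!\,m_2!\cdots m_s!}$.
   Context: For a positive integer $d$, $Pol_d\simeq\mathbb{C}P^d$ is the projective space of nonzero complex binary forms of degree $d$ up to nonzero constant factor. For a partition $\mu=(\mu_1\ge\dots\ge\mu_r)\vdash d$ with all $\mu_i\ge1$, $S_\mu\subset Pol_d$ is the set of all forms having exactly $r$ distinct roots (in $\mathbb{C}P^1$), with multiplicities $\mu_1,\dots,\mu_r$. The secant degeneracy index $\ell_\mu$ is the minimal positive integer $\ell$ such that there exist $\ell$ distinct points of $S_\mu$ which are projectively dependent, i.e. whose projective span has dimension at most $\ell-2$. For an integer $t\ge0$, $\mu^{\langle t\rangle}:=(\mu_1+t\ge\mu_2+t\ge\dots\ge\mu_r+t)$. The partition $\mu$ has a growing secant degeneracy index if $\lim_{t\to\infty}\ell_{\mu^{\langle t\rangle}}=+\infty$, and a stabilising secant degeneracy index otherwise. A solution of $f_1+\dots+f_m=0$ is a collection of pairwise non-proportional forms $f_1,\dots,f_m$ (actual nonzero forms)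 belonging to $S_\mu$ and satisfying this equation. It is a common radical solution if all $f_i$ have the same radical, i.e. the same set of distinct linear factors (up to constant factors). The symmetric group $Sym_r$ acts on $f\in S_\mu$ by permuting its $r$ distinct roots (so the orbit of $f=\prod_j L_j^{\mu_j}$, with pairwise non-proportional linear forms $L_j$, consists of the forms $\prod_j L_{\sigma(j)}^{\mu_j}$, $\sigma\in Sym_r$). *)

theory Defs
  imports
    "HOL-Computational_Algebra.Computational_Algebra"
    "HOL-Computational_Algebra.Field_as_Ring"
    "HOL-Combinatorics.Permutations"
begin

section \<open>Binary forms\<close>

text \<open>
  A polynomial in \<open>\<complex>[x, y]\<close> is a \<open>complex poly poly\<close>; the coefficient of
  \<open>x ^ i * y ^ j\<close> in \<open>f\<close> is \<open>coeff (coeff f i) j\<close>.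
\<close>

type_synonym bipoly = "complex poly poly"

definition is_form :: "nat \<Rightarrow> bipoly \<Rightarrow> bool" where
  "is_form d f \<longleftrightarrow> (\<forall>i j. coeff (coeff f i) j \<noteq> 0 \<longrightarrow> i + j = d)"

definition eval_form :: "bipoly \<Rightarrow> complex \<times> complex \<Rightarrow> complex" where
  "eval_form f z = poly (poly f [:fst z:]) (snd z)"

definition cscale :: "complex \<Rightarrow> bipoly \<Rightarrow> bipoly" where
  "cscale c f = smult [:c:] f"

interpretation form_space: vector_space cscale
  by unfold_locales (simp_all add: cscale_def smult_add_right smult_add_left [symmetric] mult.commute flip: one_pCons)

definition proportional :: "bipoly \<Rightarrow> bipoly \<Rightarrow> bool" where
  "proportional f g \<longleftrightarrow> (\<exists>c. c \<noteq> 0 \<and> f = cscale c g)"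

definition linear_form :: "bipoly \<Rightarrow> bool" where
  "linear_form L \<longleftrightarrow> L \<noteq> 0 \<and> is_form 1 L"

definition linear_factors :: "bipoly \<Rightarrow> bipoly set" where
  "linear_factors f = {L. linear_form L \<and> L dvd f}"


section \<open>Roots in the projective line\<close>

definition cp1_point :: "complex \<times> complex \<Rightarrow> (complex \<times> complex) set" where
  "cp1_point p = {(c * fst p, c * snd p) | c. c \<noteq> 0}"

definition form_roots :: "bipoly \<Rightarrow> (complex \<times> complex) set set" where
  "form_roots f = {cp1_point p | p. p \<noteq> (0, 0) \<and> eval_form f p = 0}"

text \<open>The linear form \<open>b * x - a * y\<close>, whose only root is \<open>[a : b]\<close>.\<close>

definition root_form :: "complex \<times> complex \<Rightarrow> bipoly" where
  "root_form p = [:[:0, - fst p:], [:snd p:]:]"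

lemma eval_root_form: "eval_form (root_form p) z = snd p * fst z - fst p * snd z"
  by (simp add: eval_form_def root_form_def algebra_simps)

lemma linear_form_root_form: "p \<noteq> (0, 0) \<Longrightarrow> linear_form (root_form p)"
  by (cases p)
    (auto simp: linear_form_def root_form_def is_form_def coeff_pCons split: nat.splits if_splits)


section \<open>Partitions and the strata \<open>S_\<mu>\<close>\<close>

definition is_partition :: "nat \<Rightarrow> nat list \<Rightarrow> bool" where
  "is_partition d \<mu> \<longleftrightarrow> sorted_wrt (\<ge>) \<mu> \<and> (\<forall>k\<in>set \<mu>. k \<ge> 1) \<and> sum_list \<mu> = d"

definition shift_partition :: "nat list \<Rightarrow> nat \<Rightarrow> nat list" where
  "shift_partition \<mu> t = map (\<lambda>k. k + t) \<mu>"

text \<open>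
  Forms with exactly \<open>length \<mu>\<close> distinct roots, of multiplicities given by \<open>\<mu>\<close>.
  The points \<open>p j\<close> are homogeneous coordinates of the roots; they are nonzero because no
  element of \<open>form_roots f\<close> is \<open>cp1_point (0, 0) = {(0, 0)}\<close>.
\<close>

definition S_forms :: "nat list \<Rightarrow> bipoly set" where
  "S_forms \<mu> = {f. f \<noteq> 0 \<and> is_form (sum_list \<mu>) f \<and>
     (\<exists>p :: nat \<Rightarrow> complex \<times> complex.
        bij_betw (\<lambda>j. cp1_point (p j)) {..<length \<mu>} (form_roots f) \<and>
        (\<forall>j<length \<mu>. multiplicity (root_form (p j)) f = \<mu> ! j))}"

text \<open>
  A point of the projective space of forms is the set of all nonzero multiples of a nonzero form.
\<close>

definition form_point :: "bipoly \<Rightarrow> bipoly set" where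
  "form_point f = {cscale c f | c. c \<noteq> 0}"

definition S_points :: "nat list \<Rightarrow> bipoly set set" where
  "S_points \<mu> = form_point ` S_forms \<mu>"


section \<open>Secant degeneracy index\<close>

text \<open>The dimension of the projective span of a set of points.\<close>

definition proj_span_dim :: "bipoly set set \<Rightarrow> int" where
  "proj_span_dim P = int (form_space.dim (form_space.span (\<Union>P))) - 1"

text \<open>
  For a nonempty partition of \<open>d\<close> the minimum is over a nonempty set: \<open>S_points \<mu>\<close> is infinite,
  and any \<open>d + 2\<close> points are dependent since forms of degree \<open>d\<close> have linear dimension \<open>d + 1\<close>.
\<close>

definition secant_degeneracy_index :: "nat list \<Rightarrow> nat" where
  "secant_degeneracy_index \<mu> =
     (LEAST l. l > 0 \<and>
        (\<exists>P. P \<subseteq> S_points \<mu> \<and> finite P \<and> card P = l \<and> proj_span_dim P \<le> int l - 2))"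

definition growing_index :: "nat list \<Rightarrow> bool" where
  "growing_index \<mu> \<longleftrightarrow>
     filterlim (\<lambda>t. secant_degeneracy_index (shift_partition \<mu> t)) at_top sequentially"

definition stabilising_index :: "nat list \<Rightarrow> bool" where
  "stabilising_index \<mu> \<longleftrightarrow> \<not> growing_index \<mu>"


section \<open>Common radical solutions\<close>

definition is_solution :: "nat list \<Rightarrow> nat \<Rightarrow> (nat \<Rightarrow> bipoly) \<Rightarrow> bool" where
  "is_solution \<mu> m F \<longleftrightarrow>
     (\<forall>k\<in>{1..m}. F k \<in> S_forms \<mu>) \<and>
     (\<forall>k\<in>{1..m}. \<forall>l\<in>{1..m}. k \<noteq> l \<longrightarrow> \<not> proportional (F k) (F l)) \<and>
     (\<Sum>k=1..m. F k) = 0"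

definition common_radical_solution :: "nat list \<Rightarrow> nat \<Rightarrow> (nat \<Rightarrow> bipoly) \<Rightarrow> bool" where
  "common_radical_solution \<mu> m F \<longleftrightarrow>
     is_solution \<mu> m F \<and>
     (\<forall>k\<in>{1..m}. \<forall>l\<in>{1..m}. linear_factors (F k) = linear_factors (F l))"


section \<open>Orbits of the symmetric group\<close>

definition linear_factorization :: "nat list \<Rightarrow> (nat \<Rightarrow> bipoly) \<Rightarrow> bipoly \<Rightarrow> bool" where
  "linear_factorization \<mu> L f \<longleftrightarrow>
     (\<forall>j<length \<mu>. linear_form (L j)) \<and>
     (\<forall>j<length \<mu>. \<forall>k<length \<mu>. j \<noteq> k \<longrightarrow> \<not> proportional (L j) (L k)) \<and>
     f = (\<Prod>j<length \<mu>. L j ^ (\<mu> ! j))"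

text \<open>
  The orbit of \<open>f = (\<Prod>j<length \<mu>. L j ^ (\<mu> ! j))\<close>. Another factorization of the same \<open>f\<close>
  only multiplies the members of the orbit by nonzero constants, so its span depends on \<open>f\<close> alone.
\<close>

definition sym_orbit :: "nat list \<Rightarrow> (nat \<Rightarrow> bipoly) \<Rightarrow> bipoly set" where
  "sym_orbit \<mu> L =
     {\<Prod>j<length \<mu>. L (\<sigma> j) ^ (\<mu> ! j) | \<sigma>. \<sigma> permutes {..<length \<mu>}}"

end

theory Submission imports Defs "HOL-Combinatorics.Multiset_Permutations" begin

text \<open>
  Both statements are equivalent to the following one about radicals: for no choice of \<open>r\<close> distinct
  points are the forms with these roots and with the multiplicities \<open>\<mu>\<close> in any order linearly dependent.
  A relation among them survives multiplication by the \<open>t\<close>-th power of the radical, so it bounds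
  the secant degeneracy index of every shifted partition.

  Conversely, if the index stays bounded along a subsequence, then for arbitrarily large \<open>t\<close>
  there is a relation among boundedly many forms of the shape \<open>g * R ^ t\<close>, where \<open>R\<close> is the radical
  and \<open>g\<close> has degree \<open>d\<close>. Restrict it to an affine line that meets all roots and collect the terms
  with equal radical. Powers \<open>R ^ t\<close> of different radicals cannot satisfy a nontrivial relation
  with coefficients of bounded degree once \<open>t\<close> is large: repeatedly differentiating and eliminating
  a term leads to a relation \<open>p * R ^ t = q * R' ^ t\<close> with \<open>p\<close> and \<open>q\<close> of bounded degree, which forces
  \<open>R\<close> and \<open>R'\<close> to have the same roots. So the sum over each class of equal radicals vanishes, and
  dividing it by \<open>R ^ t\<close> leaves the desired relation.
\<close>

subsection \<open>Independence of high powers of distinct radicals\<close>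

lemma degree_prod_le_card:
  fixes f :: "'b \<Rightarrow> 'a::comm_semiring_1 poly"
  assumes "finite A" "\<And>x. x \<in> A \<Longrightarrow> degree (f x) \<le> r"
  shows "degree (\<Prod>x\<in>A. f x) \<le> card A * r"
  using degree_prod_sum_le[OF assms(1), of f] sum_bounded_above[of A "degree \<circ> f" r] assms(2)
  by simp

lemma degree_mult_le_add: "degree p \<le> m \<Longrightarrow> degree q \<le> n \<Longrightarrow> degree (p * q) \<le> m + n"
  using degree_mult_le[of p q] by linarith

section \<open>Polynomials with vanishing Wronskian\<close>

text \<open>Differentiation multiplies the leading coefficient by the degree, and characteristic
  zero lets the degree be read off from that factor. Constants are separate because their derivative
  has no leading term of this shape.\<close>

lemma degree_eq_of_wronskian_eq_0:
  fixes u v :: "'a::field_char_0 poly"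
  assumes "u \<noteq> 0" "v \<noteq> 0" "pderiv u * v = pderiv v * u"
  shows "degree u = degree v"
proof -
  have *: "lead_coeff u * lead_coeff v * of_nat (degree u) = lead_coeff u * lead_coeff v * of_nat (degree v)"
  proof (cases "degree u = 0 \<or> degree v = 0")
    case True
    then have "pderiv u = 0 \<or> pderiv v = 0" by (auto simp: pderiv_eq_0_iff)
    then have "pderiv u = 0 \<and> pderiv v = 0" using assms by auto
    then show ?thesis by (simp add: pderiv_eq_0_iff)
  next
    case False
    have lc: "lead_coeff (pderiv w) = of_nat (degree w) * lead_coeff w" if "degree w \<noteq> 0" for w :: "'a poly"
      using that by (simp add: degree_pderiv coeff_pderiv)
    have "lead_coeff (pderiv u * v) = lead_coeff (pderiv v * u)" using assms(3) by simp
    then show ?thesis using False lc unfolding lead_coeff_mult by (simp add: mult_ac)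
  qed
  then show ?thesis using assms(1,2) by simp
qed

text \<open>Subtract the multiple of \<open>v\<close> that cancels the leading term of
  \<open>u\<close>. The remainder still has zero Wronskian with \<open>v\<close>, so if nonzero it
  would have the degree of \<open>v\<close>, where its coefficient has just been cancelled.\<close>

lemma proportional_of_wronskian_eq_0:
  fixes u v :: "'a::field_char_0 poly"
  assumes "u \<noteq> 0" "v \<noteq> 0" "pderiv u * v = pderiv v * u"
  obtains c where "c \<noteq> 0" "u = smult c v"
proof -
  define c where "c = lead_coeff u / lead_coeff v"
  have c: "c \<noteq> 0" using assms by (simp add: c_def)
  define w where "w = u - smult c v"
  have deg: "degree u = degree v" using degree_eq_of_wronskian_eq_0[OF assms] .
  have "w = 0"
  proof (rule ccontr)
    assume "w \<noteq> 0"
    moreover have "pderiv w * v = pderiv v * w"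
      using assms(3) by (simp add: w_def pderiv_diff pderiv_smult algebra_simps)
    ultimately have "degree w = degree v" using assms degree_eq_of_wronskian_eq_0 by blast
    moreover have "coeff w (degree v) = 0"
      using assms(2) deg by (simp add: w_def c_def)
    ultimately show False using \<open>w \<noteq> 0\<close> by (metis leading_coeff_0_iff)
  qed
  then show ?thesis using that c by (simp add: w_def)
qed

text \<open>
  Multiplying the derivative of the relation by the product of all \<open>R j\<close> gives a second relation
  whose coefficients are again of bounded degree; eliminating one term between the two
  shortens the relation.
\<close>

lemma two_term_relation:
  fixes R a :: "'i \<Rightarrow> 'a::field_char_0 poly"
  assumes J: "finite J" and R: "\<And>j. j \<in> J \<Longrightarrow> R j \<noteq> 0 \<and> degree (R j) \<le> r"
    and "I \<subseteq> J" "I \<noteq> {}"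
    and "\<And>i. i \<in> I \<Longrightarrow> a i \<noteq> 0 \<and> degree (a i) \<le> K"
    and "(\<Sum>i\<in>I. a i * R i ^ t) = 0"
  shows "\<exists>i\<in>I. \<exists>j\<in>I. i \<noteq> j \<and> (\<exists>p q. p \<noteq> 0 \<and> q \<noteq> 0 \<and>
      degree p \<le> 2 ^ card I * (K + card J * r) \<and> degree q \<le> 2 ^ card I * (K + card J * r) \<and>
      p * R i ^ t = q * R j ^ t)"
  using assms(3-6)
proof (induction "card I" arbitrary: I a K rule: less_induct)
  case less
  define M where "M = card J * r"
  have finI: "finite I" using less.prems(1) J finite_subset by blast
  define P where "P = (\<Prod>j\<in>J. R j)"
  \<comment> \<open>This is \<open>P\<close> times the logarithmic derivative of
    \<open>R i ^ t\<close>. The exponent \<open>t\<close> enters only as a scalar, so the degree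
    bound does not depend on it.\<close>
  define q where "q i = of_nat t * pderiv (R i) * (\<Prod>j\<in>J-{i}. R j)" for i
  define c where "c i = P * pderiv (a i) + a i * q i" for i
  have P0: "P \<noteq> 0" using J R by (simp add: P_def)
  have degP: "degree P \<le> M" unfolding P_def M_def using J R by (intro degree_prod_le_card) auto
  have degq: "degree (q i) \<le> M" if "i \<in> J" for i
  proof -
    have "degree (pderiv (R i)) \<le> r" using R[OF that] unfolding degree_pderiv by linarith
    moreover have "degree (\<Prod>j\<in>J-{i}. R j) \<le> card (J - {i}) * r"
      using J R by (intro degree_prod_le_card) auto
    ultimately have "degree (q i) \<le> (0 + r) + card (J - {i}) * r"
      unfolding q_def by (intro degree_mult_le_add) auto
    also have "\<dots> = M" using card_Suc_Diff1[OF J that] by (simp add: M_def flip: mult_Suc)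
    finally show ?thesis .
  qed
  have Pderiv: "P * pderiv (R i ^ t) = q i * R i ^ t" if "i \<in> J" for i
  proof (cases t)
    case 0 then show ?thesis by (simp add: q_def)
  next
    case (Suc n)
    have "P = R i * (\<Prod>j\<in>J-{i}. R j)" unfolding P_def using J that by (simp add: prod.remove)
    then show ?thesis using Suc by (simp add: q_def pderiv_power_Suc of_nat_poly algebra_simps del: power_Suc of_nat_Suc)
         (simp add: algebra_simps)
  qed
  have cder: "P * pderiv (a i * R i ^ t) = c i * R i ^ t" if "i \<in> J" for i
  proof -
    have "P * pderiv (a i * R i ^ t) = a i * (P * pderiv (R i ^ t)) + P * pderiv (a i) * R i ^ t"
      by (simp add: pderiv_mult algebra_simps)
    then show ?thesis by (simp add: Pderiv[OF that] c_def algebra_simps)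
  qed
  have degc: "degree (c i) \<le> K + M" if "i \<in> I" for i
  proof -
    have "degree (a i) \<le> K" "degree (pderiv (a i)) \<le> K" using less.prems(3)[OF that] by (auto simp: degree_pderiv)
    then have "degree (P * pderiv (a i)) \<le> M + K" "degree (a i * q i) \<le> K + M"
      using degP degq[of i] that less.prems(1) by (auto intro!: degree_mult_le_add)
    then show ?thesis unfolding c_def by (simp add: degree_add_le add.commute)
  qed
  have sumc: "(\<Sum>i\<in>I. c i * R i ^ t) = 0"
  proof -
    have "(\<Sum>i\<in>I. c i * R i ^ t) = (\<Sum>i\<in>I. P * pderiv (a i * R i ^ t))"
      using cder less.prems(1) by (intro sum.cong) auto
    also have "\<dots> = P * pderiv (\<Sum>i\<in>I. a i * R i ^ t)"
      using higher_pderiv_sum[of 1 "\<lambda>i. a i * R i ^ t" I] by (simp add: sum_distrib_left)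
    finally show ?thesis using less.prems(4) by simp
  qed
  obtain k where k: "k \<in> I" using less.prems(2) by blast
  define b where "b i = a k * c i - c k * a i" for i
  have bk: "b k = 0" by (simp add: b_def)
  have sumb: "(\<Sum>i\<in>I. b i * R i ^ t) = 0"
  proof -
    have "(\<Sum>i\<in>I. b i * R i ^ t) = a k * (\<Sum>i\<in>I. c i * R i ^ t) - c k * (\<Sum>i\<in>I. a i * R i ^ t)"
      by (simp add: b_def sum_distrib_left sum_subtractf algebra_simps)
    then show ?thesis using sumc less.prems(4) by simp
  qed
  have degb: "degree (b i) \<le> 2 * K + M" if "i \<in> I" for i
  proof -
    have "degree (a k * c i) \<le> K + (K + M)" "degree (c k * a i) \<le> (K + M) + K"
      using less.prems(3)[OF that] less.prems(3)[OF k] degc[OF that] degc[OF k]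
      by (auto intro!: degree_mult_le_add)
    then show ?thesis unfolding b_def by (intro degree_diff_le) auto
  qed
  define I' where "I' = {i\<in>I. b i \<noteq> 0}"
  show ?case
  proof (cases "I' = {}")
    case False
    have I': "I' \<subseteq> I - {k}" using bk by (auto simp: I'_def)
    then have card: "card I' < card I"
      using finI k by (metis Diff_subset card_Diff1_less card_mono finite_Diff le_less_trans)
    have "(\<Sum>i\<in>I'. b i * R i ^ t) = (\<Sum>i\<in>I. b i * R i ^ t)"
      using finI by (intro sum.mono_neutral_left) (auto simp: I'_def)
    then have s: "(\<Sum>i\<in>I'. b i * R i ^ t) = 0" using sumb by simp
    have a': "\<And>i. i \<in> I' \<Longrightarrow> b i \<noteq> 0 \<and> degree (b i) \<le> 2 * K + M" and sub: "I' \<subseteq> J"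
      using degb less.prems(1) by (auto simp: I'_def)
    obtain i j p q where ij: "i \<in> I'" "j \<in> I'" "i \<noteq> j" "p \<noteq> 0" "q \<noteq> 0"
      "degree p \<le> 2 ^ card I' * ((2*K+M) + card J * r)" "degree q \<le> 2 ^ card I' * ((2*K+M) + card J * r)"
      "p * R i ^ t = q * R j ^ t"
      using less.hyps[OF card sub False a' s] by blast
    \<comment> \<open>Elimination turns \<open>K\<close> into \<open>2*K+M\<close>, so
      \<open>K + M\<close> exactly doubles, while at least one index disappears. The factor
      \<open>2 ^ card I\<close> pays for this.\<close>
    have "2 ^ card I' * ((2*K+M) + card J * r) \<le> 2 ^ card I * (K + card J * r)"
    proof -
      have "2 ^ card I' * ((2*K+M) + card J * r) = 2 ^ Suc (card I') * (K + card J * r)"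
        by (simp add: M_def algebra_simps)
      also have "\<dots> \<le> 2 ^ card I * (K + card J * r)"
        using card by (intro mult_right_mono power_increasing) auto
      finally show ?thesis .
    qed
    then have "degree p \<le> 2 ^ card I * (K + card J * r)" "degree q \<le> 2 ^ card I * (K + card J * r)"
      using ij by linarith+
    moreover have "i \<in> I" "j \<in> I" using ij I' by auto
    ultimately show ?thesis using ij by blast
  next
    case True
    \<comment> \<open>Nothing survives the elimination. Up to the factor \<open>P\<close>, the
      vanishing \<open>b i\<close> is the Wronskian of the terms with indices \<open>i\<close> and
      \<open>k\<close>, so these two terms are proportional.\<close>
    have nz: "a i * R i ^ t \<noteq> 0" if "i \<in> I" for i using that less.prems(1,3) R by auto
    \<comment> \<open>A single nonzero term cannot sum to zero, so a second index exists.\<close>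
    have "I \<noteq> {k}" using less.prems(4) nz[OF k] by auto
    then obtain i where i: "i \<in> I" "i \<noteq> k" using k by blast
    have b0: "b i = 0" using True i by (auto simp: I'_def)
    let ?u = "a i * R i ^ t" and ?v = "a k * R k ^ t"
    have "P * (pderiv ?u * ?v - pderiv ?v * ?u) = (P * pderiv ?u) * ?v - (P * pderiv ?v) * ?u"
      by (simp add: algebra_simps)
    also have "\<dots> = c i * R i ^ t * ?v - c k * R k ^ t * ?u"
      using cder[of i] cder[of k] i k less.prems(1) by (simp only: subset_iff)
    also have "\<dots> = b i * (R i ^ t * R k ^ t)" by (simp add: b_def algebra_simps)
    finally have "P * (pderiv ?u * ?v - pderiv ?v * ?u) = 0" using b0 by simp
    then have "pderiv ?u * ?v = pderiv ?v * ?u" using P0 by simp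
    then obtain e where e: "e \<noteq> 0" "?u = smult e ?v"
      using proportional_of_wronskian_eq_0[OF nz[OF i(1)] nz[OF k]] by metis
    have le: "K \<le> 2 ^ card I * (K + card J * r)"
      by (metis add_leD1 le_add1 mult_le_mono2 mult.commute mult.right_neutral one_le_power one_le_numeral order_trans)
    have "a i * R i ^ t = smult e (a k) * R k ^ t" using e by simp
    moreover have "degree (a i) \<le> 2 ^ card I * (K + card J * r)" "degree (smult e (a k)) \<le> 2 ^ card I * (K + card J * r)"
      using less.prems(3)[OF i(1)] less.prems(3)[OF k] le e by auto
    moreover have "a i \<noteq> 0" "smult e (a k) \<noteq> 0" using less.prems(3) i k e by auto
    ultimately show ?thesis using i k by blast
  qed
qed

section \<open>Polynomials with prescribed simple roots\<close>

definition radical_poly :: "'a::comm_ring_1 set \<Rightarrow> 'a poly" where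
  "radical_poly Z = (\<Prod>z\<in>Z. [:- z, 1:])"

lemma radical_poly_nonzero [simp]: "radical_poly (Z :: 'a::idom set) \<noteq> 0"
  by (cases "finite Z") (auto simp: radical_poly_def)

lemma poly_radical_poly_eq_0_iff: "finite Z \<Longrightarrow> poly (radical_poly Z) (z :: 'a::idom) = 0 \<longleftrightarrow> z \<in> Z"
  by (auto simp: radical_poly_def poly_prod)

lemma degree_radical_poly_le: "degree (radical_poly Z) \<le> card Z"
  by (cases "finite Z") (auto simp: radical_poly_def intro: degree_prod_le_card[where r=1, THEN order_trans])

text \<open>Compare orders of vanishing at a point of \<open>Y\<close>: the left side has order at
  least \<open>t\<close>, whereas outside \<open>Z\<close> the right side has only the order of
  \<open>q\<close>, at most its degree and hence below \<open>t\<close>.\<close>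

lemma subset_of_radical_power_relation:
  fixes p q :: "'a::field_char_0 poly"
  assumes "finite Y" "finite Z" "p \<noteq> 0" "q \<noteq> 0" "degree q < t"
    and eq: "p * radical_poly Y ^ t = q * radical_poly Z ^ t"
  shows "Y \<subseteq> Z"
proof
  fix z assume z: "z \<in> Y"
  show "z \<in> Z"
  proof (rule ccontr)
    assume "z \<notin> Z"
    then have "poly (radical_poly Z ^ t) z \<noteq> 0" using assms by (simp add: poly_radical_poly_eq_0_iff)
    then have "order z (radical_poly Z ^ t) = 0" by (rule order_0I)
    then have 1: "order z (q * radical_poly Z ^ t) = order z q"
      using assms by (subst order_mult) auto
    have "[:- z, 1:] dvd radical_poly Y" using z assms by (simp add: poly_radical_poly_eq_0_iff flip: poly_eq_0_iff_dvd)
    then have "[:- z, 1:] ^ t dvd p * radical_poly Y ^ t" by (intro dvd_mult dvd_power_same)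
    then have "t \<le> order z (p * radical_poly Y ^ t)" using assms by (simp add: order_divides)
    then have "t \<le> degree q" using eq 1 order_degree[OF \<open>q \<noteq> 0\<close>, of z] by simp
    then show False using assms by simp
  qed
qed

text \<open>Apply \<open>two_term_relation\<close> to the nonzero terms. It ties two different
  radicals together with cofactors of degree below \<open>t\<close>, and comparing roots in both
  directions makes the two root sets equal.\<close>

lemma radical_powers_independent:
  fixes g :: "'a::field_char_0 set \<Rightarrow> 'a poly"
  assumes fin: "finite \<Z>" and Z: "\<And>Z. Z \<in> \<Z> \<Longrightarrow> finite Z \<and> card Z \<le> r"
    and g: "\<And>Z. Z \<in> \<Z> \<Longrightarrow> degree (g Z) \<le> K"
    and t: "2 ^ card \<Z> * (K + card \<Z> * r) < t"
    and sum: "(\<Sum>Z\<in>\<Z>. g Z * radical_poly Z ^ t) = 0"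
    and "Z \<in> \<Z>"
  shows "g Z = 0"
proof (rule ccontr)
  assume "g Z \<noteq> 0"
  define I where "I = {Z\<in>\<Z>. g Z \<noteq> 0}"
  have I: "I \<noteq> {}" "I \<subseteq> \<Z>" using \<open>g Z \<noteq> 0\<close> assms(6) by (auto simp: I_def)
  have "(\<Sum>Z\<in>I. g Z * radical_poly Z ^ t) = (\<Sum>Z\<in>\<Z>. g Z * radical_poly Z ^ t)"
    using fin by (intro sum.mono_neutral_left) (auto simp: I_def)
  then have "(\<Sum>Z\<in>I. g Z * radical_poly Z ^ t) = 0" using sum by simp
  moreover have "radical_poly Z \<noteq> 0 \<and> degree (radical_poly Z) \<le> r" if "Z \<in> \<Z>" for Z
    using Z[OF that] degree_radical_poly_le[of Z] by auto
  moreover have g': "g Z \<noteq> 0 \<and> degree (g Z) \<le> K" if "Z \<in> I" for Z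
    using that g by (auto simp: I_def)
  ultimately obtain X Y p q where *: "X \<in> I" "Y \<in> I" "X \<noteq> Y" "p \<noteq> 0" "q \<noteq> 0"
     "degree p \<le> 2 ^ card I * (K + card \<Z> * r)" "degree q \<le> 2 ^ card I * (K + card \<Z> * r)"
     "p * radical_poly X ^ t = q * radical_poly Y ^ t"
    using two_term_relation[OF fin, of radical_poly r I g K t] I g' by blast
  have "2 ^ card I * (K + card \<Z> * r) \<le> 2 ^ card \<Z> * (K + card \<Z> * r)"
    using I fin by (intro mult_right_mono power_increasing card_mono) auto
  then have "degree p < t" "degree q < t" using * t by linarith+
  then have "X \<subseteq> Y" "Y \<subseteq> X"
    using subset_of_radical_power_relation[of X Y p q t] subset_of_radical_power_relation[of Y X q p t] * I Z
    by (auto simp: subset_iff)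
  then show False using * by blast
qed

subsection \<open>Binary forms as products of linear forms\<close>

lemma eval_form_0 [simp]: "eval_form 0 z = 0"
  and eval_form_diff: "eval_form (f - g) z = eval_form f z - eval_form g z"
  and eval_form_mult: "eval_form (f * g) z = eval_form f z * eval_form g z"
  and eval_form_power: "eval_form (f ^ n) z = eval_form f z ^ n"
  and eval_form_cscale: "eval_form (cscale c f) z = c * eval_form f z"
  by (simp_all add: eval_form_def cscale_def)

lemma eval_form_sum: "eval_form (\<Sum>x\<in>A. f x) z = (\<Sum>x\<in>A. eval_form (f x) z)"
  by (simp add: eval_form_def poly_sum)

lemma eval_form_prod: "eval_form (\<Prod>x\<in>A. f x) z = (\<Prod>x\<in>A. eval_form (f x) z)"
  by (simp add: eval_form_def poly_prod)

lemma cscale_mult_left: "cscale c f * g = cscale c (f * g)"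
  and cscale_mult_right: "f * cscale c g = cscale c (f * g)"
  by (simp_all add: cscale_def)

lemma eval_form_altdef:
  "eval_form f z = (\<Sum>i\<le>degree f. poly (coeff f i) (snd z) * fst z ^ i)"
  by (simp add: eval_form_def poly_altdef[of f] poly_sum)

text \<open>A nonzero polynomial over the domain of polynomials in the second variable has finitely
  many roots, but here every constant \<open>[:x:]\<close> would be one.\<close>

lemma eq_0_of_eval_form_eq_0:
  assumes "\<And>x y. eval_form f (x, y) = 0"
  shows "f = 0"
proof (rule ccontr)
  assume "f \<noteq> 0"
  then have "finite {p. poly f p = 0}" by (rule poly_roots_finite)
  moreover have "range (\<lambda>x. [:x:]) \<subseteq> {p. poly f p = 0}"
  proof clarify
    fix x
    have "poly (poly f [:x:]) y = 0" for y using assms[of x y] by (simp add: eval_form_def)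
    then show "poly f [:x:] = 0" using poly_all_0_iff_0 by blast
  qed
  ultimately have "finite (range (\<lambda>x::complex. [:x:]))" by (rule rev_finite_subset)
  then have "finite (UNIV :: complex set)" by (rule finite_imageD) (auto simp: inj_on_def)
  then show False using infinite_UNIV_char_0 by blast
qed

section \<open>Homogeneity\<close>

lemma is_form_coeff:
  assumes "is_form D f"
  shows "coeff f i = (if i \<le> D then monom (coeff (coeff f i) (D - i)) (D - i) else 0)"
proof (rule poly_eqI)
  fix j
  have *: "coeff (coeff f i) j \<noteq> 0 \<Longrightarrow> i + j = D" for i j using assms by (simp add: is_form_def)
  show "coeff (coeff f i) j = coeff (if i \<le> D then monom (coeff (coeff f i) (D - i)) (D - i) else 0) j"
    using *[of i j] *[of i "D - i"] by (cases "i \<le> D"; cases "coeff (coeff f i) j = 0") auto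
qed

lemma eval_form_homogeneous:
  assumes "is_form D f"
  shows "eval_form f (s * x, s * y) = s ^ D * eval_form f (x, y)"
proof -
  have "poly (coeff f i) (s * y) * (s * x) ^ i = s ^ D * (poly (coeff f i) y * x ^ i)" for i
  proof (cases "i \<le> D")
    case True
    then have "s ^ D = s ^ (D - i) * s ^ i" by (simp flip: power_add)
    then show ?thesis using True
      by (subst (1 2) is_form_coeff[OF assms]) (simp add: poly_monom power_mult_distrib)
  next
    case False
    then have "coeff f i = 0" using is_form_coeff[OF assms, of i] by simp
    then show ?thesis by simp
  qed
  then show ?thesis by (simp add: eval_form_altdef sum_distrib_left)
qed

lemma is_form_mult:
  assumes "is_form a f" "is_form b g"
  shows "is_form (a + b) (f * g)"
  unfolding is_form_def
proof (intro allI impI)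
  fix i j assume "coeff (coeff (f * g) i) j \<noteq> 0"
  then obtain k where k: "k \<le> i" "coeff (coeff f k * coeff g (i - k)) j \<noteq> 0"
    by (auto simp: coeff_mult[of f g] coeff_sum elim!: sum.not_neutral_contains_not_neutral)
  then obtain l where "l \<le> j" "coeff (coeff f k) l * coeff (coeff g (i - k)) (j - l) \<noteq> 0"
    by (auto simp: coeff_mult elim!: sum.not_neutral_contains_not_neutral)
  then have "k + l = a" "(i - k) + (j - l) = b" using assms by (auto simp: is_form_def)
  then show "i + j = a + b" using k(1) \<open>l \<le> j\<close> by linarith
qed

lemma is_form_0 [simp]: "is_form D 0" by (simp add: is_form_def)

lemma is_form_1: "is_form 0 1" by (auto simp: is_form_def coeff_1 split: if_splits)

lemma is_form_add: "is_form D f \<Longrightarrow> is_form D g \<Longrightarrow> is_form D (f + g)"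
  unfolding is_form_def by (metis add.right_neutral coeff_add)

lemma is_form_cscale: "is_form D f \<Longrightarrow> is_form D (cscale c f)"
  by (auto simp: is_form_def cscale_def)

lemma is_form_sum: "(\<And>x. x \<in> A \<Longrightarrow> is_form D (f x)) \<Longrightarrow> is_form D (\<Sum>x\<in>A. f x)"
  by (induction A rule: infinite_finite_induct) (auto intro: is_form_add)

lemma is_form_power: "is_form D f \<Longrightarrow> is_form (n * D) (f ^ n)"
  by (induction n) (auto intro: is_form_1 is_form_mult)

lemma is_form_prod: "(\<And>x. x \<in> A \<Longrightarrow> is_form (D x) (f x)) \<Longrightarrow> is_form (\<Sum>x\<in>A. D x) (\<Prod>x\<in>A. f x)"
  by (induction A rule: infinite_finite_induct) (auto intro: is_form_1 is_form_mult)

text \<open>Homogeneity spreads the zeros to all lines through the origin that meet the affine line.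
  The only direction missed is the root of \<open>root_form (1, \<gamma>)\<close>, so multiplying by
  this form gives zero everywhere, and the factor can be cancelled.\<close>

lemma eq_0_of_eval_form_line_eq_0:
  assumes f: "is_form D f" and line: "\<And>T. eval_form f (T, 1 + \<gamma> * T) = 0"
  shows "f = 0"
proof -
  have "eval_form (root_form (1, \<gamma>) * f) (x, y) = 0" for x y
  proof (cases "y = \<gamma> * x")
    case True then show ?thesis by (simp add: eval_form_mult eval_root_form)
  next
    case False
    define s where "s = y - \<gamma> * x"
    have "s \<noteq> 0" using False by (simp add: s_def)
    then have "(x, y) = (s * (x / s), s * (1 + \<gamma> * (x / s)))" by (simp add: field_simps s_def)
    then have "eval_form f (x, y) = s ^ D * eval_form f (x / s, 1 + \<gamma> * (x / s))"
      using eval_form_homogeneous[OF f] by metis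
    then show ?thesis by (simp only: line eval_form_mult mult_zero_right)
  qed
  then have "root_form (1, \<gamma>) * f = 0" by (rule eq_0_of_eval_form_eq_0)
  moreover have "root_form (1, \<gamma>) \<noteq> 0" by (simp add: root_form_def)
  ultimately show ?thesis by simp
qed

text \<open>
  Along each line through the origin the cofactor is constant, because both forms scale alike;
  so it equals its value at the origin everywhere.
\<close>

lemma form_eq_cscale_of_dvd:
  assumes "is_form D f" "is_form D q" "q dvd f"
  obtains c where "f = cscale c q"
proof -
  obtain g where g: "f = q * g" using assms(3) by blast
  have "eval_form (f - cscale (eval_form g (0, 0)) q) (x, y) = 0" for x y
  proof -
    \<comment> \<open>The cofactor along the line through the origin and \<open>(x, y)\<close>, as a
      polynomial in the scaling parameter.\<close>
    define h where "h = (\<Sum>i\<le>degree g. pcompose (coeff g i) [:0, y:] * [:0, x:] ^ i)"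
    have h: "poly h s = eval_form g (s * x, s * y)" for s
      by (simp add: h_def eval_form_altdef poly_sum poly_pcompose)
    \<comment> \<open>The factor \<open>[:0, 1:] ^ D\<close> makes the identity hold at scale 0 too.
      It is cancelled as a polynomial, after which evaluation at 0 is legitimate.\<close>
    define k where "k = [:0, 1:] ^ D * ([:eval_form f (x, y):] - smult (eval_form q (x, y)) h)"
    have "poly k s = 0" for s
    proof -
      have "s ^ D * eval_form f (x, y) = s ^ D * eval_form q (x, y) * eval_form g (s * x, s * y)"
        using arg_cong[OF g, of "\<lambda>u. eval_form u (s * x, s * y)"]
        by (simp add: eval_form_mult eval_form_homogeneous[OF assms(1)] eval_form_homogeneous[OF assms(2)])
      then show ?thesis by (simp add: k_def h algebra_simps)
    qed
    then have "k = 0" using poly_all_0_iff_0 by blast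
    then have "[:eval_form f (x, y):] = smult (eval_form q (x, y)) h" by (simp add: k_def)
    then have "poly [:eval_form f (x, y):] 0 = poly (smult (eval_form q (x, y)) h) 0" by simp
    then show ?thesis using h[of 0] by (simp add: eval_form_diff eval_form_cscale)
  qed
  then have "f - cscale (eval_form g (0, 0)) q = 0" by (rule eq_0_of_eval_form_eq_0)
  then have "f = cscale (eval_form g (0, 0)) q" by simp
  then show ?thesis by (rule that)
qed

lemma is_form_root_form: "is_form 1 (root_form p)"
  by (auto simp: root_form_def is_form_def coeff_pCons split: nat.splits if_splits)

lemma root_form_eq_0_iff [simp]: "root_form p = 0 \<longleftrightarrow> p = (0, 0)"
  by (cases p) (auto simp: root_form_def)

lemma linear_form_iff: "linear_form L \<longleftrightarrow> (\<exists>p. p \<noteq> (0, 0) \<and> L = root_form p)"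
proof
  assume L: "linear_form L"
  then have f: "is_form 1 L" by (simp add: linear_form_def)
  \<comment> \<open>Read off from \<open>root_form (a, b)\<close>, which is
    \<open>b * x - a * y\<close>.\<close>
  define p where "p = (- coeff (coeff L 0) 1, coeff (coeff L 1) 0)"
  have "coeff L i = coeff (root_form p) i" for i
    by (subst is_form_coeff[OF f], subst is_form_coeff[OF is_form_root_form])
       (auto simp: le_Suc_eq root_form_def p_def)
  then have "L = root_form p" by (rule poly_eqI)
  moreover from this have "p \<noteq> (0, 0)" using L by (metis linear_form_def root_form_eq_0_iff)
  ultimately show "\<exists>p. p \<noteq> (0, 0) \<and> L = root_form p" by blast
qed (auto intro: linear_form_root_form)

section \<open>Points of the projective line and linear forms\<close>

lemma cp1_point_eq_iff:
  assumes "p \<noteq> (0, 0)" "q \<noteq> (0, 0)"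
  shows "cp1_point p = cp1_point q \<longleftrightarrow> fst p * snd q = fst q * snd p"
proof
  assume "cp1_point p = cp1_point q"
  moreover have "p \<in> cp1_point p" by (cases p) (auto simp: cp1_point_def intro!: exI[of _ 1])
  ultimately obtain c where "p = (c * fst q, c * snd q)" by (auto simp: cp1_point_def)
  then show "fst p * snd q = fst q * snd p" by simp
next
  assume eq: "fst p * snd q = fst q * snd p"
  obtain c where c: "c \<noteq> 0" "p = (c * fst q, c * snd q)"
  proof (cases "fst q = 0")
    case True
    then have "snd q \<noteq> 0" "fst p = 0" "snd p \<noteq> 0" using assms eq by (auto simp: prod_eq_iff)
    then show ?thesis using True that[of "snd p / snd q"] by (simp add: prod_eq_iff)
  next
    case False
    then have "fst p \<noteq> 0" using eq assms by (auto simp: prod_eq_iff)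
    then show ?thesis using False eq that[of "fst p / fst q"] by (simp add: prod_eq_iff field_simps)
  qed
  show "cp1_point p = cp1_point q"
  proof (intro equalityI subsetI)
    fix z assume "z \<in> cp1_point p"
    then obtain d where "d \<noteq> 0" "z = (d * fst p, d * snd p)" by (auto simp: cp1_point_def)
    then show "z \<in> cp1_point q" using c by (auto simp: cp1_point_def intro!: exI[of _ "d * c"])
  next
    fix z assume "z \<in> cp1_point q"
    then obtain d where "d \<noteq> 0" "z = (d * fst q, d * snd q)" by (auto simp: cp1_point_def)
    then show "z \<in> cp1_point p" using c by (auto simp: cp1_point_def intro!: exI[of _ "d / c"])
  qed
qed

lemma eval_root_form_eq_0_iff:
  "p \<noteq> (0, 0) \<Longrightarrow> q \<noteq> (0, 0) \<Longrightarrow> eval_form (root_form p) q = 0 \<longleftrightarrow> cp1_point q = cp1_point p"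
  by (auto simp: eval_root_form cp1_point_eq_iff algebra_simps)

lemma proportional_root_form_iff:
  assumes "p \<noteq> (0, 0)" "q \<noteq> (0, 0)"
  shows "proportional (root_form p) (root_form q) \<longleftrightarrow> cp1_point p = cp1_point q"
proof
  assume "proportional (root_form p) (root_form q)"
  then obtain c where c: "c \<noteq> 0" "root_form p = cscale c (root_form q)" by (auto simp: proportional_def)
  have "eval_form (root_form p) p = 0" by (simp add: eval_root_form)
  then have "eval_form (root_form q) p = 0" using c by (simp add: eval_form_cscale)
  then show "cp1_point p = cp1_point q" using eval_root_form_eq_0_iff assms by blast
next
  assume "cp1_point p = cp1_point q"
  moreover have "p \<in> cp1_point p" by (cases p) (auto simp: cp1_point_def intro!: exI[of _ 1])
  ultimately obtain c where c: "c \<noteq> 0" "p = (c * fst q, c * snd q)" by (auto simp: cp1_point_def)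
  then have "root_form p = cscale c (root_form q)" by (simp add: root_form_def cscale_def)
  then show "proportional (root_form p) (root_form q)" using c by (auto simp: proportional_def)
qed

text \<open>Divisibility by this polynomial is vanishing at \<open>c\<close>, so primality is the
  absence of zero divisors among values.\<close>

lemma prime_elem_linear_monic: "prime_elem [:- c, 1 :: 'a::idom_divide:]"
proof (rule prime_elemI)
  show "\<not> is_unit [:- c, 1:]" by (metis poly_eq_0_iff_dvd dvd_trans poly_1 zero_neq_one)
qed (auto simp: poly_eq_0_iff_dvd[symmetric])

text \<open>With \<open>snd p = 0\<close> only the second variable occurs, and primality is lifted
  from the coefficient ring. Otherwise division by the unit \<open>snd p\<close> makes the form
  monic in the first variable.\<close>

lemma prime_elem_root_form:
  assumes "p \<noteq> (0, 0)"
  shows "prime_elem (root_form p)"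
proof (cases "snd p = 0")
  case True
  then have "prime_elem [:0, - fst p:]" using assms by (intro prime_elem_linear_field_poly) (auto simp: prod_eq_iff)
  then show ?thesis using True lift_prime_elem_poly by (simp add: root_form_def)
next
  case False
  have "root_form p = [:[:snd p:]:] * [:- [:0, fst p / snd p:], 1:]"
    using False by (simp add: root_form_def)
  moreover have "is_unit [:[:snd p:]:]" using False by (simp add: is_unit_const_poly_iff dvd_field_iff)
  ultimately show ?thesis using prime_elem_linear_monic prime_elem_mult_unit_left by metis
qed

lemma eval_form_eq_0_of_root_form_dvd: "root_form p dvd f \<Longrightarrow> eval_form f p = 0"
  by (auto simp: dvd_def eval_form_mult eval_root_form)

section \<open>Products of powers of linear forms at distinct points\<close>

definition distinct_points :: "nat \<Rightarrow> (nat \<Rightarrow> complex \<times> complex) \<Rightarrow> bool" where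
  "distinct_points n p \<longleftrightarrow> (\<forall>j<n. p j \<noteq> (0, 0)) \<and> inj_on (\<lambda>j. cp1_point (p j)) {..<n}"

text \<open>The exponent list is attached to the points by position, so permuting roots can be
  expressed by rearranging exponents while the points stay fixed.\<close>

definition root_prod :: "(nat \<Rightarrow> complex \<times> complex) \<Rightarrow> nat list \<Rightarrow> bipoly" where
  "root_prod p \<nu> = (\<Prod>j<length \<nu>. root_form (p j) ^ (\<nu> ! j))"

lemma is_form_root_prod: "is_form (sum_list \<nu>) (root_prod p \<nu>)"
  using is_form_prod[of "{..<length \<nu>}" "\<lambda>j. \<nu> ! j * 1", OF is_form_power[OF is_form_root_form]]
  by (simp add: root_prod_def sum_list_sum_nth atLeast0LessThan)

lemma root_prod_nonzero: "distinct_points (length \<nu>) p \<Longrightarrow> root_prod p \<nu> \<noteq> 0"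
  by (auto simp: root_prod_def distinct_points_def)

lemma eval_root_form_neq_0:
  "distinct_points n p \<Longrightarrow> j < n \<Longrightarrow> k < n \<Longrightarrow> j \<noteq> k \<Longrightarrow> eval_form (root_form (p j)) (p k) \<noteq> 0"
  by (auto simp: distinct_points_def eval_root_form_eq_0_iff inj_on_def)

text \<open>Divide out one prime power at a time: the product of the earlier powers does not vanish
  at the next point, so the next power must divide the cofactor.\<close>

lemma root_prod_dvd:
  assumes "distinct_points (length \<nu>) p" "\<And>j. j < length \<nu> \<Longrightarrow> root_form (p j) ^ (\<nu> ! j) dvd f"
  shows "root_prod p \<nu> dvd f"
proof -
  have "(\<Prod>j<n. root_form (p j) ^ (\<nu> ! j)) dvd f" if "n \<le> length \<nu>" for n
    using that
  proof (induction n)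
    case (Suc n)
    let ?Q = "\<Prod>j<n. root_form (p j) ^ (\<nu> ! j)"
    obtain g where g: "f = ?Q * g" using Suc by auto
    have "eval_form ?Q (p n) \<noteq> 0"
      using eval_root_form_neq_0[OF assms(1)] Suc.prems by (auto simp: eval_form_prod eval_form_power)
    then have "\<not> root_form (p n) dvd ?Q" using eval_form_eq_0_of_root_form_dvd by blast
    moreover have "prime_elem (root_form (p n))"
      using assms(1) Suc.prems by (intro prime_elem_root_form) (auto simp: distinct_points_def)
    moreover have "root_form (p n) ^ (\<nu> ! n) dvd ?Q * g" using assms(2)[of n] Suc.prems g by simp
    ultimately have "root_form (p n) ^ (\<nu> ! n) dvd g"
      by (cases "\<nu> ! n = 0") (auto dest: prime_power_dvd_multD)
    then show ?case using g by (simp add: mult_dvd_mono)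
  qed simp
  then show ?thesis by (simp add: root_prod_def)
qed

text \<open>Once the power at \<open>p k\<close> is split off, the remaining product is nonzero at
  \<open>p k\<close>.\<close>

lemma multiplicity_root_prod:
  assumes "distinct_points (length \<nu>) p" "k < length \<nu>" "c \<noteq> 0"
  shows "multiplicity (root_form (p k)) (cscale c (root_prod p \<nu>)) = \<nu> ! k"
proof -
  let ?Q = "cscale c (\<Prod>j\<in>{..<length \<nu>}-{k}. root_form (p j) ^ (\<nu> ! j))"
  have eq: "cscale c (root_prod p \<nu>) = root_form (p k) ^ (\<nu> ! k) * ?Q"
    using assms(2) by (simp add: root_prod_def cscale_mult_right prod.remove[of "{..<length \<nu>}" k])
  have "eval_form ?Q (p k) \<noteq> 0"
    using eval_root_form_neq_0[OF assms(1)] assms by (auto simp: eval_form_prod eval_form_power eval_form_cscale)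
  then have nd: "\<not> root_form (p k) dvd ?Q" using eval_form_eq_0_of_root_form_dvd by blast
  have "root_form (p k) \<noteq> 0" using assms by (auto simp: distinct_points_def)
  then have "\<not> root_form (p k) ^ Suc (\<nu> ! k) dvd cscale c (root_prod p \<nu>)"
    unfolding eq power_Suc2 using nd by (subst dvd_times_left_cancel_iff) auto
  then show ?thesis using eq by (intro multiplicity_eqI) auto
qed

text \<open>Each exponent is a multiplicity, which nonzero scalars do not affect. Hence different
  rearrangements of the exponents give different points of projective space.\<close>

lemma root_prod_exponents_unique:
  assumes "distinct_points n p" "length \<nu> = n" "length \<nu>' = n"
    and "root_prod p \<nu> = cscale c (root_prod p \<nu>')"
  shows "\<nu> = \<nu>'"
proof (rule nth_equalityI)
  have "c \<noteq> 0" using assms root_prod_nonzero[of \<nu> p] by (auto simp: cscale_def)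
  fix k assume k: "k < length \<nu>"
  show "\<nu> ! k = \<nu>' ! k"
    using multiplicity_root_prod[of \<nu> p k 1] multiplicity_root_prod[of \<nu>' p k c] k assms \<open>c \<noteq> 0\<close>
    by simp
qed (use assms in simp)

lemma root_form_dvd_root_prod_iff:
  assumes "distinct_points (length \<nu>) p" "\<forall>k\<in>set \<nu>. k \<ge> 1" "c \<noteq> 0" "q \<noteq> (0, 0)"
  shows "root_form q dvd cscale c (root_prod p \<nu>) \<longleftrightarrow> (\<exists>j<length \<nu>. cp1_point q = cp1_point (p j))"
    and "eval_form (cscale c (root_prod p \<nu>)) q = 0 \<longleftrightarrow> (\<exists>j<length \<nu>. cp1_point q = cp1_point (p j))"
proof -
  let ?f = "cscale c (root_prod p \<nu>)"
  have p: "p j \<noteq> (0, 0)" if "j < length \<nu>" for j using assms that by (auto simp: distinct_points_def)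
  have pos: "\<nu> ! j \<noteq> 0" if "j < length \<nu>" for j using assms(2) nth_mem[OF that] by fastforce
  have ev: "eval_form ?f q = 0 \<longleftrightarrow> (\<exists>j<length \<nu>. cp1_point q = cp1_point (p j))"
    using assms(3,4) p pos by (auto simp: eval_form_cscale root_prod_def eval_form_prod eval_form_power
        eval_root_form_eq_0_iff)
  then show "eval_form ?f q = 0 \<longleftrightarrow> (\<exists>j<length \<nu>. cp1_point q = cp1_point (p j))" .
  show "root_form q dvd ?f \<longleftrightarrow> (\<exists>j<length \<nu>. cp1_point q = cp1_point (p j))"
  proof
    assume "\<exists>j<length \<nu>. cp1_point q = cp1_point (p j)"
    then obtain j where j: "j < length \<nu>" "cp1_point q = cp1_point (p j)" by blast
    then obtain e where e: "e \<noteq> 0" "root_form (p j) = cscale e (root_form q)"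
      using proportional_root_form_iff[OF p[OF j(1)] assms(4)] unfolding proportional_def by metis
    have "root_form q dvd root_form (p j)"
      unfolding e by (simp add: cscale_def dvd_smult)
    also have "\<dots> dvd root_form (p j) ^ (\<nu> ! j)" using pos[OF j(1)] by (intro dvd_power) auto
    also have "\<dots> dvd root_prod p \<nu>" unfolding root_prod_def using j by (intro dvd_prodI) auto
    also have "\<dots> dvd ?f" by (simp add: cscale_def dvd_smult)
    finally show "root_form q dvd ?f" .
  qed (use ev eval_form_eq_0_of_root_form_dvd in blast)
qed

section \<open>Explicit description of the strata\<close>

text \<open>The prescribed multiplicities make the product divide \<open>f\<close>, and equal
  degrees force the quotient to be constant. Conversely, positive exponents make the given points
  exactly the roots, with the right multiplicities.\<close>

lemma S_forms_iff:
  assumes pos: "\<forall>k\<in>set \<mu>. k \<ge> 1"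
  shows "f \<in> S_forms \<mu> \<longleftrightarrow>
    (\<exists>c p. c \<noteq> 0 \<and> distinct_points (length \<mu>) p \<and> f = cscale c (root_prod p \<mu>))"
proof
  assume "f \<in> S_forms \<mu>"
  then obtain p where f: "f \<noteq> 0" "is_form (sum_list \<mu>) f"
    and bij: "bij_betw (\<lambda>j. cp1_point (p j)) {..<length \<mu>} (form_roots f)"
    and mult: "\<And>j. j < length \<mu> \<Longrightarrow> multiplicity (root_form (p j)) f = \<mu> ! j"
    by (auto simp: S_forms_def)
  have "p j \<noteq> (0, 0)" if "j < length \<mu>" for j
  proof
    assume 0: "p j = (0, 0)"
    have "cp1_point (p j) \<in> form_roots f" using bij that by (auto simp: bij_betw_def)
    then obtain q where q: "cp1_point (p j) = cp1_point q" "q \<noteq> (0, 0)" by (auto simp: form_roots_def)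
    have "q \<in> cp1_point q" by (cases q) (auto simp: cp1_point_def intro!: exI[of _ 1])
    then have "q \<in> cp1_point (0, 0)" using q 0 by simp
    then show False using q by (auto simp: cp1_point_def)
  qed
  then have p: "distinct_points (length \<mu>) p" using bij by (auto simp: distinct_points_def bij_betw_def)
  have "root_prod p \<mu> dvd f" using p
  proof (rule root_prod_dvd)
    fix j assume "j < length \<mu>"
    then show "root_form (p j) ^ (\<mu> ! j) dvd f" using mult by (metis multiplicity_dvd)
  qed
  then obtain c where c: "f = cscale c (root_prod p \<mu>)"
    using form_eq_cscale_of_dvd[OF f(2) is_form_root_prod] by blast
  then have "c \<noteq> 0" using f by (auto simp: cscale_def)
  then show "\<exists>c p. c \<noteq> 0 \<and> distinct_points (length \<mu>) p \<and> f = cscale c (root_prod p \<mu>)" using c p by blast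
next
  assume "\<exists>c p. c \<noteq> 0 \<and> distinct_points (length \<mu>) p \<and> f = cscale c (root_prod p \<mu>)"
  then obtain c p where c: "c \<noteq> 0" and p: "distinct_points (length \<mu>) p" and f: "f = cscale c (root_prod p \<mu>)"
    by blast
  have roots: "form_roots f = (\<lambda>j. cp1_point (p j)) ` {..<length \<mu>}"
  proof (intro equalityI subsetI)
    fix x assume "x \<in> form_roots f"
    then show "x \<in> (\<lambda>j. cp1_point (p j)) ` {..<length \<mu>}"
      using root_form_dvd_root_prod_iff(2)[OF p pos c] unfolding f form_roots_def by auto
  next
    fix x assume "x \<in> (\<lambda>j. cp1_point (p j)) ` {..<length \<mu>}"
    then obtain j where j: "j < length \<mu>" "x = cp1_point (p j)" by auto
    then have "p j \<noteq> (0, 0)" using p by (auto simp: distinct_points_def)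
    moreover from this have "eval_form f (p j) = 0"
      using root_form_dvd_root_prod_iff(2)[OF p pos c, of "p j"] j f by blast
    ultimately show "x \<in> form_roots f" using j unfolding form_roots_def by blast
  qed
  have "f \<noteq> 0" using f c root_prod_nonzero[OF p] by (simp add: cscale_def)
  moreover have "is_form (sum_list \<mu>) f" using f is_form_cscale is_form_root_prod by blast
  moreover have "bij_betw (\<lambda>j. cp1_point (p j)) {..<length \<mu>} (form_roots f)"
    using p roots by (auto simp: bij_betw_def distinct_points_def)
  moreover have "\<forall>j<length \<mu>. multiplicity (root_form (p j)) f = \<mu> ! j"
    using multiplicity_root_prod[OF p _ c] f by blast
  ultimately show "f \<in> S_forms \<mu>" by (auto simp: S_forms_def)
qed

subsection \<open>Orbits and dependent secants\<close>

lemma proportional_refl: "proportional f f"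
  unfolding proportional_def by (metis form_space.scale_one zero_neq_one)

lemma proportional_sym: "proportional f g \<Longrightarrow> proportional g f"
  unfolding proportional_def
proof clarify
  fix c :: complex assume "c \<noteq> 0"
  then show "\<exists>d. d \<noteq> 0 \<and> g = cscale d (cscale c g)"
    by (intro exI[of _ "inverse c"]) simp
qed

lemma proportional_cscale_iff: "c \<noteq> 0 \<Longrightarrow> d \<noteq> 0 \<Longrightarrow> proportional (cscale c f) (cscale d g) \<longleftrightarrow> proportional f g"
  unfolding proportional_def
proof safe
  fix e :: complex assume "c \<noteq> 0" "d \<noteq> 0" "e \<noteq> 0" "cscale c f = cscale e (cscale d g)"
  then have "cscale (inverse c) (cscale c f) = cscale (inverse c * e * d) g" by (simp add: mult_ac)
  then have "f = cscale (inverse c * e * d) g" using \<open>c \<noteq> 0\<close> by simp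
  then show "\<exists>c. c \<noteq> 0 \<and> f = cscale c g" using \<open>c \<noteq> 0\<close> \<open>d \<noteq> 0\<close> \<open>e \<noteq> 0\<close> by (intro exI[of _ "inverse c * e * d"]) auto
next
  fix e :: complex assume "c \<noteq> 0" "d \<noteq> 0" "e \<noteq> 0"
  then show "\<exists>e'. e' \<noteq> 0 \<and> cscale c (cscale e g) = cscale e' (cscale d g)"
    by (intro exI[of _ "c * e / d"]) auto
qed

lemma form_point_eq_iff: "form_point f = form_point g \<longleftrightarrow> proportional f g"
proof
  assume "form_point f = form_point g"
  moreover have "f \<in> form_point f" using proportional_refl[of f] by (auto simp: form_point_def proportional_def)
  ultimately show "proportional f g" by (auto simp: form_point_def proportional_def)
next
  have *: "form_point f \<subseteq> form_point g" if fg: "proportional f g" for f g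
  proof
    fix h assume "h \<in> form_point f"
    then obtain c where "c \<noteq> 0" "h = cscale c f" by (auto simp: form_point_def)
    moreover obtain d where "d \<noteq> 0" "f = cscale d g" using fg by (auto simp: proportional_def)
    ultimately show "h \<in> form_point g" by (auto simp: form_point_def intro!: exI[of _ "c * d"])
  qed
  assume "proportional f g"
  then show "form_point f = form_point g" using * proportional_sym by blast
qed

lemma cscale_power: "cscale c f ^ n = cscale (c ^ n) (f ^ n)"
  by (induction n) (simp_all add: cscale_mult_left cscale_mult_right mult_ac)

lemma cscale_prod: "(\<Prod>x\<in>A. cscale (c x) (f x)) = cscale (\<Prod>x\<in>A. c x) (\<Prod>x\<in>A. f x)"
  by (induction A rule: infinite_finite_induct)
    (simp_all add: cscale_mult_left cscale_mult_right mult_ac)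

lemma root_prod_cong: "(\<And>j. j < length \<nu> \<Longrightarrow> p j = p' j) \<Longrightarrow> root_prod p \<nu> = root_prod p' \<nu>"
  by (auto simp: root_prod_def intro!: prod.cong)

lemma root_prod_rescale:
  assumes "distinct_points (length \<nu>) p" "distinct_points (length \<nu>) p'"
    and "\<And>j. j < length \<nu> \<Longrightarrow> cp1_point (p j) = cp1_point (p' j)"
  obtains c where "c \<noteq> 0" "root_prod p \<nu> = cscale c (root_prod p' \<nu>)"
proof -
  have "\<exists>e. e \<noteq> 0 \<and> root_form (p j) = cscale e (root_form (p' j))" if "j < length \<nu>" for j
    using proportional_root_form_iff[of "p j" "p' j"] assms that
    by (auto simp: distinct_points_def proportional_def)
  then obtain e where e: "\<And>j. j < length \<nu> \<Longrightarrow> e j \<noteq> 0 \<and> root_form (p j) = cscale (e j) (root_form (p' j))"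
    by metis
  have "root_prod p \<nu> = (\<Prod>j<length \<nu>. cscale (e j) (root_form (p' j)) ^ (\<nu> ! j))"
    unfolding root_prod_def using e by (intro prod.cong) auto
  also have "\<dots> = cscale (\<Prod>j<length \<nu>. e j ^ (\<nu> ! j)) (root_prod p' \<nu>)"
    by (simp add: cscale_prod cscale_power root_prod_def)
  finally have "root_prod p \<nu> = cscale (\<Prod>j<length \<nu>. e j ^ (\<nu> ! j)) (root_prod p' \<nu>)" .
  moreover have "(\<Prod>j<length \<nu>. e j ^ (\<nu> ! j)) \<noteq> 0" using e by auto
  ultimately show ?thesis using that by blast
qed

text \<open>Reindexing the product along \<open>\<sigma>\<close> moves the permutation from the
  points to the exponents, where it acts by its inverse.\<close>

lemma root_prod_permute:
  assumes "\<sigma> permutes {..<length \<nu>}"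
  shows "root_prod (\<lambda>j. p (\<sigma> j)) \<nu> = root_prod p (permute_list (inv \<sigma>) \<nu>)"
proof -
  have inv: "inv \<sigma> permutes {..<length \<nu>}" using assms by (rule permutes_inv)
  have "root_prod p (permute_list (inv \<sigma>) \<nu>) = (\<Prod>k<length \<nu>. root_form (p k) ^ (\<nu> ! inv \<sigma> k))"
    unfolding root_prod_def by (intro prod.cong) (auto simp: permute_list_nth[OF inv])
  also have "\<dots> = (\<Prod>k<length \<nu>. root_form (p (\<sigma> k)) ^ (\<nu> ! inv \<sigma> (\<sigma> k)))"
    using prod.permute[OF assms, of "\<lambda>k. root_form (p k) ^ (\<nu> ! inv \<sigma> k)"] by (simp add: o_def)
  also have "\<dots> = root_prod (\<lambda>j. p (\<sigma> j)) \<nu>"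
    using assms by (simp add: root_prod_def permutes_inverses)
  finally show ?thesis by simp
qed

lemma distinct_points_permute:
  assumes "distinct_points n p" "\<sigma> permutes {..<n}"
  shows "distinct_points n (\<lambda>j. p (\<sigma> j))"
proof -
  have "inj_on ((\<lambda>j. cp1_point (p j)) \<circ> \<sigma>) {..<n}"
    using assms by (intro comp_inj_on) (auto simp: distinct_points_def permutes_inj_on permutes_image)
  moreover have "\<sigma> j < n" if "j < n" for j using permutes_in_image[OF assms(2), of j] that by simp
  ultimately show ?thesis using assms(1) by (auto simp: distinct_points_def o_def)
qed

section \<open>Orbits as rearrangements of exponents\<close>

text \<open>Permutations that only exchange equal multiplicities are identified from the start. For
  distinct points the orbit is thus counted by multiset permutations, that is, by the multinomial
  coefficient.\<close>

definition root_orbit :: "(nat \<Rightarrow> complex \<times> complex) \<Rightarrow> nat list \<Rightarrow> bipoly set" where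
  "root_orbit p \<mu> = root_prod p ` permutations_of_multiset (mset \<mu>)"

lemma root_prod_permute_in_orbit:
  "\<sigma> permutes {..<length \<mu>} \<Longrightarrow> root_prod (\<lambda>j. p (\<sigma> j)) \<mu> \<in> root_orbit p \<mu>"
  by (simp add: root_prod_permute root_orbit_def permutations_of_multisetI permutes_inv)

lemma root_orbitE:
  assumes "w \<in> root_orbit p \<mu>"
  obtains \<sigma> where "\<sigma> permutes {..<length \<mu>}" "w = root_prod (\<lambda>j. p (\<sigma> j)) \<mu>"
proof -
  obtain \<nu> where \<nu>: "mset \<nu> = mset \<mu>" "w = root_prod p \<nu>"
    using assms by (auto simp: root_orbit_def dest: permutations_of_multisetD)
  then obtain \<pi> where \<pi>: "\<pi> permutes {..<length \<mu>}" "permute_list \<pi> \<mu> = \<nu>"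
    using mset_eq_permutation by metis
  then have "w = root_prod (\<lambda>j. p (inv \<pi> j)) \<mu>"
    using root_prod_permute[OF permutes_inv[OF \<pi>(1)], of p] \<nu> by (simp add: permutes_inv_inv)
  then show ?thesis using that permutes_inv[OF \<pi>(1)] by blast
qed

lemma sym_orbit_root_form: "sym_orbit \<mu> (\<lambda>j. root_form (p j)) = root_orbit p \<mu>"
proof -
  have "sym_orbit \<mu> (\<lambda>j. root_form (p j)) = {root_prod (\<lambda>j. p (\<sigma> j)) \<mu> | \<sigma>. \<sigma> permutes {..<length \<mu>}}"
    by (simp add: sym_orbit_def root_prod_def)
  also have "\<dots> = root_orbit p \<mu>"
    using root_prod_permute_in_orbit root_orbitE by blast
  finally show ?thesis .
qed

lemma finite_root_orbit [simp]: "finite (root_orbit p \<mu>)"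
  by (simp add: root_orbit_def)

lemma root_orbit_proportional_imp_eq:
  assumes p: "distinct_points (length \<mu>) p" and "v \<in> root_orbit p \<mu>" "w \<in> root_orbit p \<mu>" "proportional v w"
  shows "v = w"
proof -
  obtain \<nu> \<nu>' where *: "mset \<nu> = mset \<mu>" "mset \<nu>' = mset \<mu>" "v = root_prod p \<nu>" "w = root_prod p \<nu>'"
    using assms by (auto simp: root_orbit_def dest: permutations_of_multisetD)
  then have "length \<nu> = length \<mu>" "length \<nu>' = length \<mu>" using mset_eq_length by blast+
  then have "\<nu> = \<nu>'" using root_prod_exponents_unique[OF p, of \<nu> \<nu>'] * assms(4) by (auto simp: proportional_def)
  then show ?thesis using * by simp
qed

lemma inj_on_root_prod:
  assumes "distinct_points (length \<mu>) p"
  shows "inj_on (root_prod p) (permutations_of_multiset (mset \<mu>))"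
proof (rule inj_onI)
  fix \<nu> \<nu>' assume *: "\<nu> \<in> permutations_of_multiset (mset \<mu>)" "\<nu>' \<in> permutations_of_multiset (mset \<mu>)"
    and eq: "root_prod p \<nu> = root_prod p \<nu>'"
  then have "length \<nu> = length \<mu>" "length \<nu>' = length \<mu>" by (metis permutations_of_multisetD mset_eq_length)+
  then show "\<nu> = \<nu>'" using root_prod_exponents_unique[OF assms, of \<nu> \<nu>' 1] eq by simp
qed

lemma card_root_orbit:
  "distinct_points (length \<mu>) p \<Longrightarrow> card (root_orbit p \<mu>) = card (permutations_of_multiset (mset \<mu>))"
  unfolding root_orbit_def by (intro card_image inj_on_root_prod)

lemma cscale_root_orbit_in_S_forms:
  assumes "\<forall>k\<in>set \<mu>. k \<ge> 1" "distinct_points (length \<mu>) p" "w \<in> root_orbit p \<mu>" "c \<noteq> 0"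
  shows "cscale c w \<in> S_forms \<mu>"
proof -
  obtain \<sigma> where "\<sigma> permutes {..<length \<mu>}" "w = root_prod (\<lambda>j. p (\<sigma> j)) \<mu>"
    using root_orbitE[OF assms(3)] by blast
  then show ?thesis using S_forms_iff[OF assms(1)] distinct_points_permute[OF assms(2)] assms(4) by blast
qed

lemma ex_permutation_of_image_eq:
  fixes n :: nat
  assumes "inj_on a {..<n}" "inj_on b {..<n}" "a ` {..<n} = b ` {..<n}"
  obtains \<sigma> where "\<sigma> permutes {..<n}" "\<And>j. j < n \<Longrightarrow> a j = b (\<sigma> j)"
proof -
  \<comment> \<open>The index at which \<open>b\<close> takes the value \<open>a j\<close>, extended
    by the identity as \<open>permutes\<close> demands.\<close>
  define \<sigma> where "\<sigma> j = (if j < n then inv_into {..<n} b (a j) else j)" for j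
  have "bij_betw a {..<n} (b ` {..<n})" using assms by (simp add: bij_betw_def)
  moreover have "bij_betw (inv_into {..<n} b) (b ` {..<n}) {..<n}"
    using assms by (intro bij_betw_inv_into inj_on_imp_bij_betw)
  ultimately have "bij_betw (inv_into {..<n} b \<circ> a) {..<n} {..<n}" by (rule bij_betw_trans)
  then have "bij_betw \<sigma> {..<n} {..<n}"
    by (rule bij_betw_cong[THEN iffD1, rotated]) (auto simp: \<sigma>_def)
  then have "\<sigma> permutes {..<n}" by (rule bij_imp_permutes) (auto simp: \<sigma>_def)
  moreover have "a j = b (\<sigma> j)" if "j < n" for j
  proof -
    have "a j \<in> b ` {..<n}" using that assms(3) by blast
    then show ?thesis using that by (simp add: \<sigma>_def f_inv_into_f)
  qed
  ultimately show ?thesis using that by blast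
qed

section \<open>Linear relations\<close>

text \<open>Injectivity of \<open>w\<close> keeps terms with different indices from merging, so the
  nonzero coefficient survives as the coefficient of a vector.\<close>

lemma dependent_image:
  assumes "finite A" "inj_on w A" "(\<Sum>x\<in>A. cscale (u x) (w x)) = 0" "x \<in> A" "u x \<noteq> 0"
  shows "form_space.dependent (w ` A)"
proof -
  define u' where "u' v = u (inv_into A w v)" for v
  have "(\<Sum>v\<in>w ` A. cscale (u' v) v) = (\<Sum>x\<in>A. cscale (u x) (w x))"
    using assms(2) by (subst sum.reindex) (auto simp: u'_def intro!: sum.cong)
  moreover have "u' (w x) \<noteq> 0" using assms by (simp add: u'_def)
  ultimately show ?thesis using assms
    by (subst form_space.dependent_finite) (auto intro!: exI[of _ u'])
qed

text \<open>Vectors with coefficient zero are discarded, so that any vector of \<open>A\<close> may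
  later serve as the one witnessing nontriviality.\<close>

lemma dependent_relation:
  assumes "finite B" "form_space.dependent B"
  obtains A u where "A \<subseteq> B" "A \<noteq> {}" "\<And>v. v \<in> A \<Longrightarrow> u v \<noteq> 0" "(\<Sum>v\<in>A. cscale (u v) v) = 0"
proof -
  obtain u w where u: "w \<in> B" "u w \<noteq> 0" "(\<Sum>v\<in>B. cscale (u v) v) = 0"
    using assms form_space.dependent_finite by blast
  have "(\<Sum>v\<in>{v\<in>B. u v \<noteq> 0}. cscale (u v) v) = (\<Sum>v\<in>B. cscale (u v) v)"
    using assms(1) by (intro sum.mono_neutral_left) auto
  then have "(\<Sum>v\<in>{v\<in>B. u v \<noteq> 0}. cscale (u v) v) = 0" using u(3) by (rule trans)
  moreover have "{v\<in>B. u v \<noteq> 0} \<noteq> {}" using u(1,2) by blast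
  ultimately show ?thesis by (intro that[of "{v\<in>B. u v \<noteq> 0}" u]) auto
qed

section \<open>Dependent points and dependent forms\<close>

text \<open>Each projective point is replaced by one representative form; distinctness of the points
  becomes pairwise non-proportionality.\<close>

definition degenerate_secant :: "nat list \<Rightarrow> bipoly set \<Rightarrow> bool" where
  "degenerate_secant \<mu> B \<longleftrightarrow> B \<subseteq> S_forms \<mu> \<and> finite B \<and>
     (\<forall>f\<in>B. \<forall>g\<in>B. proportional f g \<longrightarrow> f = g) \<and> form_space.dependent B"

text \<open>Choosing representatives does not change the linear span, and projective dimension at
  most \<open>l - 2\<close> means linear dimension below \<open>l\<close>, which for
  \<open>l\<close> vectors is dependence.\<close>

lemma degenerate_points_iff:
  "(\<exists>P. P \<subseteq> S_points \<mu> \<and> finite P \<and> card P = l \<and> proj_span_dim P \<le> int l - 2) \<longleftrightarrow>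
   (\<exists>B. degenerate_secant \<mu> B \<and> card B = l)"
proof
  assume "\<exists>P. P \<subseteq> S_points \<mu> \<and> finite P \<and> card P = l \<and> proj_span_dim P \<le> int l - 2"
  then obtain P where P: "P \<subseteq> S_points \<mu>" "finite P" "card P = l" "proj_span_dim P \<le> int l - 2" by blast
  then have "\<forall>x\<in>P. \<exists>f\<in>S_forms \<mu>. form_point f = x" by (auto simp: S_points_def)
  then obtain h where h: "\<And>x. x \<in> P \<Longrightarrow> h x \<in> S_forms \<mu> \<and> form_point (h x) = x" by metis
  have inj: "inj_on h P" using h by (metis inj_onI)
  have span: "form_space.span (\<Union>P) = form_space.span (h ` P)"
  proof (intro form_space.span_eq[THEN iffD2] conjI subsetI)
    fix f assume "f \<in> \<Union>P"
    then obtain x where x: "x \<in> P" "f \<in> form_point (h x)" using h by auto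
    then obtain c where "f = cscale c (h x)" by (auto simp: form_point_def)
    then show "f \<in> form_space.span (h ` P)"
      using x by (simp add: form_space.span_scale form_space.span_base)
  next
    fix f assume "f \<in> h ` P"
    then obtain x where x: "x \<in> P" "f = h x" by auto
    have "f \<in> form_point f" using proportional_refl[of f] by (auto simp: form_point_def proportional_def)
    then show "f \<in> form_space.span (\<Union>P)" using h x by (auto intro!: form_space.span_base)
  qed
  have "form_space.dependent (h ` P)"
  proof (rule ccontr)
    assume "\<not> form_space.dependent (h ` P)"
    then have "form_space.dim (form_space.span (\<Union>P)) = card (h ` P)"
      unfolding span by (simp add: form_space.dim_eq_card_independent)
    then show False using P card_image[OF inj] by (simp add: proj_span_dim_def)
  qed
  moreover have "f = g" if "f \<in> h ` P" "g \<in> h ` P" "proportional f g" for f g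
    using that h form_point_eq_iff by (metis imageE)
  ultimately have "degenerate_secant \<mu> (h ` P)" using h P by (auto simp: degenerate_secant_def)
  then show "\<exists>B. degenerate_secant \<mu> B \<and> card B = l" using card_image[OF inj] P by blast
next
  assume "\<exists>B. degenerate_secant \<mu> B \<and> card B = l"
  then obtain B where B: "B \<subseteq> S_forms \<mu>" "finite B" "\<forall>f\<in>B. \<forall>g\<in>B. proportional f g \<longrightarrow> f = g"
    "form_space.dependent B" "card B = l"
    by (auto simp: degenerate_secant_def)
  have inj: "inj_on form_point B" using B form_point_eq_iff by (meson inj_onI)
  obtain b where b: "b \<in> B" "b \<in> form_space.span (B - {b})" using B(4) by (auto simp: form_space.dependent_def)
  have sub: "\<Union>(form_point ` B) \<subseteq> form_space.span (B - {b})"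
  proof
    fix f assume "f \<in> \<Union>(form_point ` B)"
    then obtain g c where "g \<in> B" "f = cscale c g" by (auto simp: form_point_def)
    then show "f \<in> form_space.span (B - {b})"
      using b(2) by (cases "g = b") (auto intro: form_space.span_scale form_space.span_base)
  qed
  have "form_space.dim (form_space.span (\<Union>(form_point ` B))) \<le> card (B - {b})"
    using form_space.dim_le_card[OF sub] B by simp
  moreover have "card (B - {b}) + 1 = l" using b B card_Suc_Diff1 by fastforce
  ultimately have "proj_span_dim (form_point ` B) \<le> int l - 2" by (simp add: proj_span_dim_def)
  then show "\<exists>P. P \<subseteq> S_points \<mu> \<and> finite P \<and> card P = l \<and> proj_span_dim P \<le> int l - 2"
    using B card_image[OF inj] by (intro exI[of _ "form_point ` B"]) (auto simp: S_points_def)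
qed

lemma degenerate_secant_card_pos: "degenerate_secant \<mu> B \<Longrightarrow> card B > 0"
  by (auto simp: degenerate_secant_def card_gt_0_iff form_space.independent_empty)

lemma secant_degeneracy_index_altdef:
  "secant_degeneracy_index \<mu> = (LEAST l. \<exists>B. degenerate_secant \<mu> B \<and> card B = l)"
proof -
  have "(\<lambda>l. l > 0 \<and> (\<exists>B. degenerate_secant \<mu> B \<and> card B = l)) =
      (\<lambda>l. \<exists>B. degenerate_secant \<mu> B \<and> card B = l)"
    using degenerate_secant_card_pos by fastforce
  then show ?thesis by (simp only: secant_degeneracy_index_def degenerate_points_iff)
qed

lemma secant_degeneracy_index_le: "degenerate_secant \<mu> B \<Longrightarrow> secant_degeneracy_index \<mu> \<le> card B"
  unfolding secant_degeneracy_index_altdef by (rule Least_le) blast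

text \<open>Supplies the bound \<open>D + 1\<close> on the number of independent forms of degree
  \<open>D\<close>.\<close>

lemma form_in_span_monomials:
  assumes "is_form D f"
  shows "f \<in> form_space.span ((\<lambda>i. monom (monom 1 (D - i)) i) ` {..D})"
proof -
  let ?E = "\<lambda>i. monom (monom 1 (D - i)) i :: bipoly"
  have E: "cscale c (?E i) = monom (monom c (D - i)) i" for c i
    by (simp add: cscale_def smult_monom)
  have "f = (\<Sum>i\<le>D. cscale (coeff (coeff f i) (D - i)) (?E i))"
  proof (rule poly_eqI)
    fix k
    have "coeff (\<Sum>i\<le>D. cscale (coeff (coeff f i) (D - i)) (?E i)) k =
        (\<Sum>i\<le>D. if i = k then monom (coeff (coeff f i) (D - i)) (D - i) else 0)"
      by (simp add: E coeff_sum)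
    also have "\<dots> = coeff f k" by (subst (2) is_form_coeff[OF assms]) simp
    finally show "coeff f k = coeff (\<Sum>i\<le>D. cscale (coeff (coeff f i) (D - i)) (?E i)) k" by simp
  qed
  also have "\<dots> \<in> form_space.span (?E ` {..D})"
    by (intro form_space.span_sum form_space.span_scale form_space.span_base) auto
  finally show ?thesis .
qed

text \<open>Ensures that the minimum defining the index is attained. Forms with disjoint root sets
  are never proportional, and \<open>D + 2\<close> of them exceed the dimension of the space of
  forms.\<close>

lemma ex_degenerate_secant:
  assumes pos: "\<forall>k\<in>set \<mu>. k \<ge> 1" and ne: "\<mu> \<noteq> []"
  shows "\<exists>B. degenerate_secant \<mu> B"
proof -
  define n where "n = length \<mu>"
  have n: "n > 0" using ne by (simp add: n_def)
  define D where "D = sum_list \<mu>"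
  \<comment> \<open>Disjoint blocks of \<open>n\<close> consecutive integers serve as root sets, so
    the block number \<open>k\<close> is recovered from any root by division by
    \<open>n\<close>.\<close>
  define p :: "nat \<Rightarrow> nat \<Rightarrow> complex \<times> complex" where "p k j = (of_nat (k * n + j), 1)" for k j
  have p: "cp1_point (p k j) = cp1_point (p l i) \<longleftrightarrow> k * n + j = l * n + i" for k j l i
    by (subst cp1_point_eq_iff) (auto simp: p_def simp flip: of_nat_mult of_nat_add simp del: of_nat_mult of_nat_add)
  have dist: "distinct_points n (p k)" for k
    using p by (auto simp: distinct_points_def inj_on_def p_def simp del: of_nat_mult of_nat_add)
  define F where "F k = root_prod (p k) \<mu>" for k
  have p0: "p l i \<noteq> (0, 0)" for l i by (simp add: p_def)
  have F0: "eval_form (cscale c (F k)) (p l i) = 0 \<longleftrightarrow> (\<exists>j<n. l * n + i = k * n + j)" if "c \<noteq> 0" for c k l i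
    using root_form_dvd_root_prod_iff(2)[OF dist[unfolded n_def] pos that p0] unfolding F_def p n_def .
  have F: "k = l" if pr: "proportional (F k) (F l)" for k l
  proof -
    obtain c where c: "c \<noteq> 0" "F k = cscale c (F l)" using pr unfolding proportional_def by blast
    have "eval_form (cscale 1 (F k)) (p k 0) = 0" using F0[of 1 k k 0] n by auto
    then have "eval_form (cscale c (F l)) (p k 0) = 0" unfolding c(2)[symmetric] by simp
    then obtain j where "j < n" "k * n + 0 = l * n + j" using F0[OF c(1), of l k 0] by blast
    then have "k * n = l * n + j" by simp
    then have "(k * n) div n = (l * n + j) div n" by (rule arg_cong)
    then show ?thesis using \<open>j < n\<close> by simp
  qed
  then have inj: "inj F" by (metis injI proportional_refl)
  \<comment> \<open>The index set \<open>{..D+1}\<close> has \<open>D + 2\<close> elements, one more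
    than the spanning monomials.\<close>
  let ?B = "F ` {..D+1}"
  have card: "card ?B = D + 2" using inj by (simp add: card_image inj_on_subset)
  have "form_space.dependent ?B"
  proof (rule ccontr)
    assume ind: "\<not> form_space.dependent ?B"
    have "?B \<subseteq> form_space.span ((\<lambda>i. monom (monom 1 (D - i)) i) ` {..D})"
      unfolding F_def D_def using form_in_span_monomials[OF is_form_root_prod] by blast
    then have "card ?B \<le> card ((\<lambda>i. monom (monom 1 (D - i)) i :: bipoly) ` {..D})"
      using form_space.independent_span_bound[OF _ ind] by blast
    also have "\<dots> \<le> D + 1" using card_image_le[of "{..D}"] by simp
    finally show False using card by simp
  qed
  moreover have "F k \<in> S_forms \<mu>" for k
    unfolding S_forms_iff[OF pos] F_def using dist n_def by (metis form_space.scale_one zero_neq_one)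
  ultimately have "degenerate_secant \<mu> ?B" using F by (auto simp: degenerate_secant_def)
  then show ?thesis by blast
qed

lemma secant_degeneracy_indexE:
  assumes "\<forall>k\<in>set \<mu>. k \<ge> 1" "\<mu> \<noteq> []"
  obtains B where "degenerate_secant \<mu> B" "card B = secant_degeneracy_index \<mu>"
proof -
  have "\<exists>l B. degenerate_secant \<mu> B \<and> card B = l" using ex_degenerate_secant[OF assms] by blast
  then have "\<exists>B. degenerate_secant \<mu> B \<and> card B = secant_degeneracy_index \<mu>"
    unfolding secant_degeneracy_index_altdef by (rule LeastI_ex)
  then show ?thesis using that by blast
qed

subsection \<open>Shifted partitions\<close>

lemma length_shift_partition [simp]: "length (shift_partition \<mu> t) = length \<mu>"
  and shift_partition_nth: "j < length \<mu> \<Longrightarrow> shift_partition \<mu> t ! j = \<mu> ! j + t"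
  by (simp_all add: shift_partition_def)

lemma shift_partition_pos: "\<forall>k\<in>set \<mu>. k \<ge> 1 \<Longrightarrow> \<forall>k\<in>set (shift_partition \<mu> t). k \<ge> 1"
  by (auto simp: shift_partition_def)

section \<open>From bounded index to a dependent orbit\<close>

text \<open>A root is at infinity for the line of points \<open>(T, 1 + \<gamma> * T)\<close> only
  if \<open>\<gamma>\<close> is its slope, so finitely many values must be avoided. For a root with
  first coordinate 0 the quotient is 0 by convention, which merely excludes one more value.\<close>

lemma ex_affine_chart:
  assumes "finite B" "\<And>f. f \<in> B \<Longrightarrow> distinct_points n (P f)"
  obtains \<gamma> where "\<And>f j. f \<in> B \<Longrightarrow> j < n \<Longrightarrow> snd (P f j) - \<gamma> * fst (P f j) \<noteq> 0"
proof -
  have "finite ((\<lambda>(f, j). snd (P f j) / fst (P f j)) ` (B \<times> {..<n}))" using assms by simp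
  then obtain \<gamma> where \<gamma>: "\<gamma> \<notin> (\<lambda>(f, j). snd (P f j) / fst (P f j)) ` (B \<times> {..<n})"
    using ex_new_if_finite[OF infinite_UNIV_char_0] by blast
  have "snd (P f j) - \<gamma> * fst (P f j) \<noteq> 0" if fj: "f \<in> B" "j < n" for f j
  proof (cases "fst (P f j) = 0")
    case True
    have "P f j \<noteq> (0, 0)" using assms(2)[OF fj(1)] fj(2) by (simp add: distinct_points_def)
    then show ?thesis using True by (simp add: prod_eq_iff)
  next
    case False
    have "\<gamma> \<noteq> snd (P f j) / fst (P f j)" using \<gamma> fj by force
    then show ?thesis using False by (simp add: field_simps)
  qed
  then show ?thesis by (rule that)
qed

text \<open>The threshold on \<open>t\<close> is that of \<open>radical_powers_independent\<close>
  for at most \<open>N\<close> radicals of degree at most \<open>length \<mu>\<close>, with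
  coefficients of degree at most \<open>sum_list \<mu>\<close>.\<close>

lemma dependent_orbit_of_degenerate_secant:
  assumes pos: "\<forall>k\<in>set \<mu>. k \<ge> 1"
    and B: "degenerate_secant (shift_partition \<mu> t) B" "card B \<le> N"
    and t: "2 ^ N * (sum_list \<mu> + N * length \<mu>) < t"
  shows "\<exists>p. distinct_points (length \<mu>) p \<and> form_space.dependent (root_orbit p \<mu>)"
proof -
  define n where "n = length \<mu>"
  have finB: "finite B" and BS: "B \<subseteq> S_forms (shift_partition \<mu> t)"
    and Bp: "\<And>f g. f \<in> B \<Longrightarrow> g \<in> B \<Longrightarrow> proportional f g \<Longrightarrow> f = g" and Bd: "form_space.dependent B"
    using B(1) by (auto simp: degenerate_secant_def)
  obtain A u where A: "A \<subseteq> B" "A \<noteq> {}" and u: "\<And>f. f \<in> A \<Longrightarrow> u f \<noteq> 0"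
    and sum0: "(\<Sum>f\<in>A. cscale (u f) f) = 0"
    by (rule dependent_relation[OF finB Bd]) blast
  have finA: "finite A" using A finB finite_subset by blast
  have "\<forall>f\<in>A. \<exists>c p. c \<noteq> 0 \<and> distinct_points n p \<and> f = cscale c (root_prod p (shift_partition \<mu> t))"
    using A BS unfolding n_def S_forms_iff[OF shift_partition_pos[OF pos]] subset_iff by simp
  then obtain c P where c: "\<And>f. f \<in> A \<Longrightarrow> c f \<noteq> 0" and P: "\<And>f. f \<in> A \<Longrightarrow> distinct_points n (P f)"
    and f: "\<And>f. f \<in> A \<Longrightarrow> f = cscale (c f) (root_prod (P f) (shift_partition \<mu> t))"
    by metis
  obtain \<gamma> where \<gamma>: "\<And>f j. f \<in> A \<Longrightarrow> j < n \<Longrightarrow> snd (P f j) - \<gamma> * fst (P f j) \<noteq> 0"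
    using ex_affine_chart[of A n P, OF finA P] by blast
  \<comment> \<open>On the line, \<open>root_form (a, b)\<close> becomes
    \<open>(b - \<gamma> * a) * T - a\<close>: \<open>w\<close> is its leading coefficient and
    \<open>z\<close> its root.\<close>
  define w where "w f j = snd (P f j) - \<gamma> * fst (P f j)" for f j
  define z where "z f j = fst (P f j) / w f j" for f j
  have w: "w f j \<noteq> 0" if "f \<in> A" "j < n" for f j using \<gamma> that by (simp add: w_def)
  have lin: "eval_form (root_form (P f j)) (T, 1 + \<gamma> * T) = w f j * (T - z f j)" if "f \<in> A" "j < n" for f j T
  proof -
    have "w f j * z f j = fst (P f j)" using w[OF that] by (simp add: z_def)
    then show ?thesis by (simp add: eval_root_form right_diff_distrib) (simp add: w_def algebra_simps)
  qed
  have inj: "inj_on (z f) {..<n}" if fA: "f \<in> A" for f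
  proof (rule inj_onI)
    fix j k assume jk: "j \<in> {..<n}" "k \<in> {..<n}" "z f j = z f k"
    then have "fst (P f j) * w f k = fst (P f k) * w f j"
      using w[OF fA] by (auto simp: z_def field_simps)
    then have "fst (P f j) * snd (P f k) = fst (P f k) * snd (P f j)" by (simp add: w_def algebra_simps)
    moreover have "P f j \<noteq> (0, 0)" "P f k \<noteq> (0, 0)" using P[OF fA] jk by (auto simp: distinct_points_def)
    ultimately have "cp1_point (P f j) = cp1_point (P f k)" by (simp add: cp1_point_eq_iff)
    then show "j = k" using P[OF fA] jk by (auto simp: distinct_points_def inj_on_def)
  qed
  define Z where "Z f = z f ` {..<n}" for f
  \<comment> \<open>The restriction of \<open>f\<close> splits into a constant \<open>e f\<close>, a
    part \<open>q f\<close> whose degree does not grow with \<open>t\<close>, and the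
    \<open>t\<close>-th power of the radical.\<close>
  define e where "e f = c f * (\<Prod>j<n. w f j ^ (\<mu> ! j + t))" for f
  define q where "q f = (\<Prod>j<n. [:- z f j, 1:] ^ (\<mu> ! j))" for f
  have e: "e f \<noteq> 0" if "f \<in> A" for f using that c w by (simp add: e_def)
  have rad: "radical_poly (Z f) = (\<Prod>j<n. [:- z f j, 1:])" if "f \<in> A" for f
    unfolding radical_poly_def Z_def using inj[OF that] by (subst prod.reindex) auto
  have eval_f: "eval_form f (T, 1 + \<gamma> * T) = e f * poly (q f * radical_poly (Z f) ^ t) T" if fA: "f \<in> A" for f T
  proof -
    have "eval_form (root_prod (P f) (shift_partition \<mu> t)) (T, 1 + \<gamma> * T) =
        (\<Prod>j<n. (w f j * (T - z f j)) ^ (\<mu> ! j + t))"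
      unfolding root_prod_def eval_form_prod eval_form_power
      using lin[OF fA] by (intro prod.cong) (auto simp: n_def shift_partition_nth)
    also have "\<dots> = (\<Prod>j<n. w f j ^ (\<mu> ! j + t)) * poly (q f * radical_poly (Z f) ^ t) T"
      by (simp add: rad[OF fA] q_def poly_prod prod.distrib power_mult_distrib power_add prod_power_distrib)
    finally show ?thesis by (subst f[OF fA]) (simp add: eval_form_cscale e_def)
  qed
  \<comment> \<open>The total coefficient of the power belonging to the root set \<open>Y\<close>.
    It must vanish although none of its summands does.\<close>
  define g where "g Y = (\<Sum>f\<in>{f\<in>A. Z f = Y}. smult (u f * e f) (q f))" for Y
  have degq: "degree (q f) \<le> sum_list \<mu>" for f
  proof -
    have "degree (q f) = (\<Sum>j<n. \<mu> ! j)"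
      by (simp add: q_def degree_prod_eq_sum_degree degree_power_eq)
    then show ?thesis by (simp add: sum_list_sum_nth atLeast0LessThan n_def)
  qed
  have g0: "g (Z f0) = 0" if "f0 \<in> A" for f0
  proof (rule radical_powers_independent)
    show "finite (Z ` A)" "Z f0 \<in> Z ` A" using finA that by auto
    show "finite Y \<and> card Y \<le> n" if "Y \<in> Z ` A" for Y
      using that card_image_le[of "{..<n}"] by (auto simp: Z_def)
    show "degree (g Y) \<le> sum_list \<mu>" for Y
      unfolding g_def using finA degq by (intro degree_sum_le) (auto intro: order_trans[OF degree_smult_le])
    have card: "card (Z ` A) \<le> N"
      using card_image_le[OF finA, of Z] card_mono[OF finB A(1)] B(2) by linarith
    then have "2 ^ card (Z ` A) * (sum_list \<mu> + card (Z ` A) * n) \<le> 2 ^ N * (sum_list \<mu> + N * n)"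
      by (intro mult_mono power_increasing add_left_mono mult_right_mono) auto
    then show "2 ^ card (Z ` A) * (sum_list \<mu> + card (Z ` A) * n) < t" using t by (simp add: n_def)
    have "(\<Sum>Y\<in>Z ` A. g Y * radical_poly Y ^ t) =
        (\<Sum>Y\<in>Z ` A. \<Sum>f\<in>{f\<in>A. Z f = Y}. smult (u f * e f) (q f) * radical_poly (Z f) ^ t)"
      unfolding g_def sum_distrib_right by (intro sum.cong) auto
    also have "\<dots> = (\<Sum>f\<in>A. smult (u f * e f) (q f) * radical_poly (Z f) ^ t)"
      by (rule sum.image_gen[symmetric]) (rule finA)
    also have "\<dots> = 0"
    proof -
      \<comment> \<open>The values of this polynomial are those of the original relation on the
        chosen line.\<close>
      have "poly (\<Sum>f\<in>A. smult (u f * e f) (q f) * radical_poly (Z f) ^ t) T =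
          eval_form (\<Sum>f\<in>A. cscale (u f) f) (T, 1 + \<gamma> * T)" for T
        unfolding poly_sum eval_form_sum using eval_f by (intro sum.cong) (simp_all add: eval_form_cscale)
      then have "poly (\<Sum>f\<in>A. smult (u f * e f) (q f) * radical_poly (Z f) ^ t) T = 0" for T
        unfolding sum0 by simp
      then show ?thesis using poly_all_0_iff_0 by blast
    qed
    finally show "(\<Sum>Y\<in>Z ` A. g Y * radical_poly Y ^ t) = 0" .
  qed
  obtain f0 where f0: "f0 \<in> A" using A by blast
  define C where "C = {f\<in>A. Z f = Z f0}"
  \<comment> \<open>The factor \<open>q f\<close> made homogeneous again. The points
    \<open>(z f j, 1)\<close> arise from \<open>P f j\<close> by the linear map sending
    \<open>(x, y)\<close> to \<open>(x, y - \<gamma> * x)\<close>, up to scaling.\<close>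
  define W where "W f = root_prod (\<lambda>j. (z f j, 1)) \<mu>" for f
  have eval_W: "eval_form (W f) (T, 1) = poly (q f) T" for f T
    by (simp add: W_def root_prod_def eval_form_prod eval_form_power eval_root_form q_def poly_prod n_def)
  define p :: "nat \<Rightarrow> complex \<times> complex" where "p j = (z f0 j, 1)" for j
  have p: "distinct_points n p"
    using inj[OF f0] by (auto simp: distinct_points_def p_def inj_on_def cp1_point_eq_iff)
  have WC: "W ` C \<subseteq> root_orbit p \<mu>"
  proof clarify
    fix f assume "f \<in> C"
    then have fA: "f \<in> A" and "z f ` {..<n} = z f0 ` {..<n}" by (auto simp: C_def Z_def)
    then obtain \<sigma> where \<sigma>: "\<sigma> permutes {..<n}" "\<And>j. j < n \<Longrightarrow> z f j = z f0 (\<sigma> j)"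
      using ex_permutation_of_image_eq[OF inj[OF fA] inj[OF f0]] by metis
    have "W f = root_prod (\<lambda>j. p (\<sigma> j)) \<mu>"
      unfolding W_def by (rule root_prod_cong) (simp add: p_def \<sigma>(2) n_def)
    then show "W f \<in> root_orbit p \<mu>" using root_prod_permute_in_orbit \<sigma>(1) n_def by metis
  qed
  \<comment> \<open>If two forms of the class have equal \<open>q\<close>, they are proportional on
    the line, hence proportional as forms, hence equal, since \<open>B\<close> contains no two
    proportional forms.\<close>
  have "inj_on W C"
  proof (rule inj_onI)
    fix f h assume fh: "f \<in> C" "h \<in> C" "W f = W h"
    then have fA: "f \<in> A" "h \<in> A" "Z f = Z h" by (auto simp: C_def)
    have "poly (q f) T = poly (q h) T" for T using eval_W[of f T] eval_W[of h T] fh(3) by simp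
    then have "q f = q h" by (simp add: poly_eq_poly_eq_iff[symmetric] fun_eq_iff)
    then have "eval_form (f - cscale (e f / e h) h) (T, 1 + \<gamma> * T) = 0" for T
      using eval_f[OF fA(1)] eval_f[OF fA(2)] fA(3) e[OF fA(2)] by (simp add: eval_form_diff eval_form_cscale)
    moreover have "is_form (sum_list (shift_partition \<mu> t)) (f - cscale (e f / e h) h)"
    proof -
      have F: "is_form (sum_list (shift_partition \<mu> t)) v" if "v \<in> A" for v
        using A BS that by (auto simp: S_forms_def)
      have eq: "f - cscale (e f / e h) h = f + cscale (- (e f / e h)) h" by simp
      show ?thesis unfolding eq by (intro is_form_add is_form_cscale F fA)
    qed
    ultimately have "f - cscale (e f / e h) h = 0" by (rule eq_0_of_eval_form_line_eq_0[rotated])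
    then have "proportional f h"
      unfolding proportional_def using e fA by (intro exI[of _ "e f / e h"]) auto
    then show "f = h" using Bp fA A by blast
  qed
  \<comment> \<open>On the line with slope 0 this sum restricts to \<open>g (Z f0)\<close>, which is
    zero.\<close>
  moreover have "(\<Sum>f\<in>C. cscale (u f * e f) (W f)) = 0"
  proof (rule eq_0_of_eval_form_line_eq_0)
    show "is_form (sum_list \<mu>) (\<Sum>f\<in>C. cscale (u f * e f) (W f))"
      unfolding W_def by (intro is_form_sum is_form_cscale is_form_root_prod)
    show "eval_form (\<Sum>f\<in>C. cscale (u f * e f) (W f)) (T, 1 + 0 * T) = 0" for T
    proof -
      have "eval_form (\<Sum>f\<in>C. cscale (u f * e f) (W f)) (T, 1) = poly (g (Z f0)) T"
        by (simp add: eval_form_sum eval_form_cscale eval_W g_def C_def poly_sum)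
      then show ?thesis using g0[OF f0] by simp
    qed
  qed
  moreover have "f0 \<in> C" "u f0 * e f0 \<noteq> 0" using f0 u e by (auto simp: C_def)
  moreover have "finite C" using finA by (simp add: C_def)
  ultimately have "form_space.dependent (W ` C)" by (intro dependent_image[where u="\<lambda>f. u f * e f"])
  then have "form_space.dependent (root_orbit p \<mu>)" using WC form_space.dependent_mono by blast
  then show ?thesis using p n_def by blast
qed

section \<open>From a dependent orbit to bounded index\<close>

lemma degenerate_secant_of_dependent_orbit:
  assumes "\<forall>k\<in>set \<mu>. k \<ge> 1" "distinct_points (length \<mu>) p" "form_space.dependent (root_orbit p \<mu>)"
  shows "degenerate_secant \<mu> (root_orbit p \<mu>)"
  unfolding degenerate_secant_def
  using assms root_orbit_proportional_imp_eq cscale_root_orbit_in_S_forms[OF assms(1,2), of _ 1] by auto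

text \<open>The \<open>t\<close> additional copies of every root contribute the same factor to each
  rearrangement.\<close>

lemma root_orbit_shift_partition:
  "root_orbit p (shift_partition \<mu> t) = (\<lambda>f. f * (\<Prod>j<length \<mu>. root_form (p j)) ^ t) ` root_orbit p \<mu>"
proof -
  have "root_prod p (map (\<lambda>k. k + t) \<nu>) = root_prod p \<nu> * (\<Prod>j<length \<mu>. root_form (p j)) ^ t"
    if "\<nu> \<in> permutations_of_multiset (mset \<mu>)" for \<nu>
  proof -
    have "length \<nu> = length \<mu>" using that by (metis permutations_of_multisetD mset_eq_length)
    then show ?thesis by (simp add: root_prod_def power_add prod.distrib prod_power_distrib)
  qed
  then show ?thesis
    by (auto simp: root_orbit_def shift_partition_def permutations_of_multiset_image image_image intro!: image_cong)
qed

text \<open>Multiplication by a nonzero form is linear and injective, so it carries a nontrivial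
  relation to a nontrivial relation.\<close>

lemma dependent_orbit_shift:
  assumes p: "distinct_points (length \<mu>) p" and dep: "form_space.dependent (root_orbit p \<mu>)"
  shows "form_space.dependent (root_orbit p (shift_partition \<mu> t))"
proof -
  let ?R = "(\<Prod>j<length \<mu>. root_form (p j)) ^ t"
  have R: "?R \<noteq> 0" using p by (auto simp: distinct_points_def)
  obtain A u where A: "A \<subseteq> root_orbit p \<mu>" "A \<noteq> {}" "\<And>v. v \<in> A \<Longrightarrow> u v \<noteq> 0" "(\<Sum>v\<in>A. cscale (u v) v) = 0"
    by (rule dependent_relation[OF finite_root_orbit dep]) blast
  obtain v where "v \<in> A" using A by blast
  have "(\<Sum>v\<in>A. cscale (u v) (v * ?R)) = (\<Sum>v\<in>A. cscale (u v) v) * ?R"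
    by (simp add: sum_distrib_right cscale_mult_left)
  then have "(\<Sum>v\<in>A. cscale (u v) (v * ?R)) = 0" using A(4) by simp
  then have "form_space.dependent ((\<lambda>f. f * ?R) ` A)"
    using A \<open>v \<in> A\<close> R finite_subset[OF A(1)] by (intro dependent_image[where u=u and x=v]) (auto simp: inj_on_def)
  then show ?thesis
    unfolding root_orbit_shift_partition by (rule form_space.dependent_mono[OF _ image_mono[OF A(1)]])
qed

text \<open>The size of a dependent orbit bounds the index for all shifts at once. Conversely, if
  the index does not tend to infinity, some \<open>N\<close> exceeds it for arbitrarily large
  shifts.\<close>

lemma stabilising_index_iff:
  assumes pos: "\<forall>k\<in>set \<mu>. k \<ge> 1" and ne: "\<mu> \<noteq> []"
  shows "stabilising_index \<mu> \<longleftrightarrow>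
    (\<exists>p. distinct_points (length \<mu>) p \<and> form_space.dependent (root_orbit p \<mu>))"
proof
  assume "stabilising_index \<mu>"
  then obtain N where N: "\<not> (\<forall>\<^sub>F t in sequentially. N \<le> secant_degeneracy_index (shift_partition \<mu> t))"
    by (auto simp: stabilising_index_def growing_index_def filterlim_at_top)
  then have ex: "\<exists>t\<ge>t0. \<not> N \<le> secant_degeneracy_index (shift_partition \<mu> t)" for t0
    unfolding eventually_sequentially by blast
  \<comment> \<open>One such shift beyond the threshold of
    \<open>dependent_orbit_of_degenerate_secant\<close> is enough.\<close>
  obtain t where t: "t \<ge> Suc (2 ^ N * (sum_list \<mu> + N * length \<mu>))"
    "secant_degeneracy_index (shift_partition \<mu> t) < N"
    using ex not_le by blast
  have "shift_partition \<mu> t \<noteq> []" using ne by (simp add: shift_partition_def)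
  then obtain B where "degenerate_secant (shift_partition \<mu> t) B"
      "card B = secant_degeneracy_index (shift_partition \<mu> t)"
    using secant_degeneracy_indexE[OF shift_partition_pos[OF pos]] by blast
  then show "\<exists>p. distinct_points (length \<mu>) p \<and> form_space.dependent (root_orbit p \<mu>)"
    using t by (intro dependent_orbit_of_degenerate_secant[OF pos, of t B N]) auto
next
  assume "\<exists>p. distinct_points (length \<mu>) p \<and> form_space.dependent (root_orbit p \<mu>)"
  then obtain p where p: "distinct_points (length \<mu>) p" "form_space.dependent (root_orbit p \<mu>)" by blast
  have le: "secant_degeneracy_index (shift_partition \<mu> t) \<le> card (root_orbit p \<mu>)" for t
  proof -
    have "degenerate_secant (shift_partition \<mu> t) (root_orbit p (shift_partition \<mu> t))"
      using p dependent_orbit_shift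
      by (intro degenerate_secant_of_dependent_orbit shift_partition_pos[OF pos]) auto
    then have "secant_degeneracy_index (shift_partition \<mu> t) \<le> card (root_orbit p (shift_partition \<mu> t))"
      by (rule secant_degeneracy_index_le)
    also have "\<dots> \<le> card (root_orbit p \<mu>)"
      unfolding root_orbit_shift_partition by (rule card_image_le) simp
    finally show ?thesis .
  qed
  show "stabilising_index \<mu>"
    unfolding stabilising_index_def growing_index_def
  proof
    assume "filterlim (\<lambda>t. secant_degeneracy_index (shift_partition \<mu> t)) at_top sequentially"
    then have "\<forall>\<^sub>F t in sequentially. Suc (card (root_orbit p \<mu>)) \<le> secant_degeneracy_index (shift_partition \<mu> t)"
      by (simp add: filterlim_at_top)
    then obtain t where "Suc (card (root_orbit p \<mu>)) \<le> secant_degeneracy_index (shift_partition \<mu> t)"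
      unfolding eventually_sequentially by blast
    then show False using le[of t] by simp
  qed
qed

subsection \<open>Common radical solutions\<close>

lemma linear_factors_root_prod:
  assumes "distinct_points (length \<nu>) p" "\<forall>k\<in>set \<nu>. k \<ge> 1" "c \<noteq> 0"
  shows "linear_factors (cscale c (root_prod p \<nu>)) =
    {root_form q | q. q \<noteq> (0, 0) \<and> (\<exists>j<length \<nu>. cp1_point q = cp1_point (p j))}"
  unfolding linear_factors_def linear_form_iff using root_form_dvd_root_prod_iff(1)[OF assms] by blast

text \<open>Equal linear factors mean equal root sets, so up to scalars all summands lie in the
  orbit on the roots of \<open>F 1\<close>. Non-proportional summands give different orbit elements,
  so the equation is a nontrivial relation in that orbit.\<close>

lemma dependent_orbit_of_common_radical_solution:
  assumes pos: "\<forall>k\<in>set \<mu>. k \<ge> 1" and m: "m > 0" and F: "common_radical_solution \<mu> m F"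
  shows "\<exists>p. distinct_points (length \<mu>) p \<and> form_space.dependent (root_orbit p \<mu>)"
proof -
  define n where "n = length \<mu>"
  have F: "\<And>k. k \<in> {1..m} \<Longrightarrow> F k \<in> S_forms \<mu>"
    "\<And>k l. k \<in> {1..m} \<Longrightarrow> l \<in> {1..m} \<Longrightarrow> k \<noteq> l \<Longrightarrow> \<not> proportional (F k) (F l)"
    "(\<Sum>k=1..m. F k) = 0"
    "\<And>k l. k \<in> {1..m} \<Longrightarrow> l \<in> {1..m} \<Longrightarrow> linear_factors (F k) = linear_factors (F l)"
    using F unfolding common_radical_solution_def is_solution_def by blast+
  have "\<forall>k\<in>{1..m}. \<exists>c p. c \<noteq> 0 \<and> distinct_points n p \<and> F k = cscale c (root_prod p \<mu>)"
    using F(1) S_forms_iff[OF pos] n_def by blast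
  then obtain c P where c: "\<And>k. k \<in> {1..m} \<Longrightarrow> c k \<noteq> 0"
    and P: "\<And>k. k \<in> {1..m} \<Longrightarrow> distinct_points n (P k)"
    and FP: "\<And>k. k \<in> {1..m} \<Longrightarrow> F k = cscale (c k) (root_prod (P k) \<mu>)"
    by metis
  \<comment> \<open>Used in both directions, this shows that any two summands have the same
    roots.\<close>
  have sub: "(\<lambda>j. cp1_point (P k j)) ` {..<n} \<subseteq> (\<lambda>j. cp1_point (P l j)) ` {..<n}"
    if kl: "k \<in> {1..m}" "l \<in> {1..m}" for k l
  proof clarify
    fix j assume j: "j < n"
    have Pj: "P k j \<noteq> (0, 0)" using P[OF kl(1)] j by (simp add: distinct_points_def)
    have "root_form (P k j) dvd F k"
      unfolding FP[OF kl(1)] using root_form_dvd_root_prod_iff(1)[OF _ pos c[OF kl(1)] Pj] P[OF kl(1)] j n_def by blast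
    then have "root_form (P k j) \<in> linear_factors (F l)"
      using F(4)[OF kl] linear_form_root_form[OF Pj] by (auto simp: linear_factors_def)
    then have "root_form (P k j) dvd F l" by (simp add: linear_factors_def)
    then show "cp1_point (P k j) \<in> (\<lambda>j. cp1_point (P l j)) ` {..<n}"
      unfolding FP[OF kl(2)] using root_form_dvd_root_prod_iff(1)[OF _ pos c[OF kl(2)] Pj] P[OF kl(2)] n_def by blast
  qed
  define p where "p = P 1"
  have one: "1 \<in> {1..m}" using m by simp
  have p: "distinct_points n p" using P[OF one] by (simp add: p_def)
  have "\<exists>w d. w \<in> root_orbit p \<mu> \<and> d \<noteq> 0 \<and> F k = cscale d w" if k: "k \<in> {1..m}" for k
  proof -
    obtain \<sigma> where \<sigma>: "\<sigma> permutes {..<n}" "\<And>j. j < n \<Longrightarrow> cp1_point (P k j) = cp1_point (p (\<sigma> j))"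
      using ex_permutation_of_image_eq[of "\<lambda>j. cp1_point (P k j)" n "\<lambda>j. cp1_point (p j)"]
        P[OF k] p sub[OF k one] sub[OF one k]
      unfolding distinct_points_def p_def by (metis subset_antisym)
    then obtain d where d: "d \<noteq> 0" "root_prod (P k) \<mu> = cscale d (root_prod (\<lambda>j. p (\<sigma> j)) \<mu>)"
      using root_prod_rescale[of \<mu> "P k" "\<lambda>j. p (\<sigma> j)"] P[OF k] distinct_points_permute[OF p] n_def by blast
    have "F k = cscale (c k * d) (root_prod (\<lambda>j. p (\<sigma> j)) \<mu>)" using FP[OF k] d by simp
    moreover have "root_prod (\<lambda>j. p (\<sigma> j)) \<mu> \<in> root_orbit p \<mu>"
      using root_prod_permute_in_orbit \<sigma>(1) n_def by metis
    ultimately show ?thesis using c[OF k] d by (meson mult_eq_0_iff)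
  qed
  then obtain w d where w: "\<And>k. k \<in> {1..m} \<Longrightarrow> w k \<in> root_orbit p \<mu>" "\<And>k. k \<in> {1..m} \<Longrightarrow> d k \<noteq> 0"
    "\<And>k. k \<in> {1..m} \<Longrightarrow> F k = cscale (d k) (w k)"
    by metis
  have "inj_on w {1..m}"
  proof (rule inj_onI, rule ccontr)
    fix k l assume kl: "k \<in> {1..m}" "l \<in> {1..m}" "w k = w l" "k \<noteq> l"
    have "proportional (F k) (F l)"
      unfolding w(3)[OF kl(1)] w(3)[OF kl(2)] kl(3)
      using proportional_cscale_iff[OF w(2)[OF kl(1)] w(2)[OF kl(2)]] proportional_refl by blast
    then show False using F(2) kl by blast
  qed
  moreover have "(\<Sum>k=1..m. cscale (d k) (w k)) = 0"
    using F(3) sum.cong[OF refl w(3), of "{1..m}"] by simp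
  ultimately have "form_space.dependent (w ` {1..m})"
    using one w(2)[OF one] by (intro dependent_image[where u=d and x=1]) auto
  moreover have "w ` {1..m} \<subseteq> root_orbit p \<mu>" using w(1) by blast
  ultimately have "form_space.dependent (root_orbit p \<mu>)" using form_space.dependent_mono by blast
  then show ?thesis using p n_def by blast
qed

text \<open>Absorb the nonzero coefficients of a relation into its forms and enumerate them. All
  have the points \<open>p\<close> as roots, because rearranged exponents stay positive.\<close>

lemma common_radical_solution_of_dependent_orbit:
  assumes pos: "\<forall>k\<in>set \<mu>. k \<ge> 1" and p: "distinct_points (length \<mu>) p"
    and dep: "form_space.dependent (root_orbit p \<mu>)"
  shows "\<exists>m F. m > 0 \<and> common_radical_solution \<mu> m F"
proof -
  obtain A u where A: "A \<subseteq> root_orbit p \<mu>" "A \<noteq> {}" "\<And>v. v \<in> A \<Longrightarrow> u v \<noteq> 0" "(\<Sum>v\<in>A. cscale (u v) v) = 0"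
    by (rule dependent_relation[OF finite_root_orbit dep]) blast
  have fin: "finite A" using finite_subset[OF A(1)] by simp
  then obtain h where h: "bij_betw h {1..card A} A" using ex_bij_betw_nat_finite_1 by blast
  then have hA: "h k \<in> A" if "k \<in> {1..card A}" for k using that by (auto simp: bij_betw_def)
  define F where "F k = cscale (u (h k)) (h k)" for k
  have S: "F k \<in> S_forms \<mu>" if "k \<in> {1..card A}" for k
    unfolding F_def using cscale_root_orbit_in_S_forms[OF pos p] A hA[OF that] by blast
  have np: "\<not> proportional (F k) (F l)" if "k \<in> {1..card A}" "l \<in> {1..card A}" "k \<noteq> l" for k l
  proof
    assume "proportional (F k) (F l)"
    then have "proportional (h k) (h l)"
      unfolding F_def using proportional_cscale_iff A(3) hA that by blast
    then have "h k = h l" using root_orbit_proportional_imp_eq[OF p] A(1) hA that by blast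
    then show False using inj_onD[OF bij_betw_imp_inj_on[OF h]] that by blast
  qed
  have sum: "(\<Sum>k=1..card A. F k) = 0"
    using A(4) sum.reindex_bij_betw[OF h, of "\<lambda>v. cscale (u v) v"] by (simp add: F_def)
  have lf: "linear_factors (F k) =
      {root_form q | q. q \<noteq> (0, 0) \<and> (\<exists>j<length \<mu>. cp1_point q = cp1_point (p j))}" if k: "k \<in> {1..card A}" for k
  proof -
    obtain \<nu> where \<nu>: "mset \<nu> = mset \<mu>" "h k = root_prod p \<nu>"
      using hA[OF k] A(1) by (auto simp: root_orbit_def dest: permutations_of_multisetD)
    then have len: "length \<nu> = length \<mu>" and "set \<nu> = set \<mu>" by (metis mset_eq_length, metis mset_eq_setD)
    then have "linear_factors (cscale (u (h k)) (root_prod p \<nu>)) =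
        {root_form q | q. q \<noteq> (0, 0) \<and> (\<exists>j<length \<nu>. cp1_point q = cp1_point (p j))}"
      using p pos A(3)[OF hA[OF k]] by (intro linear_factors_root_prod) simp_all
    then show ?thesis unfolding F_def \<nu>(2)[symmetric] len .
  qed
  have "is_solution \<mu> (card A) F" unfolding is_solution_def using S np sum by blast
  then have "common_radical_solution \<mu> (card A) F"
    unfolding common_radical_solution_def using lf by auto
  moreover have "card A > 0" using A(2) fin by (simp add: card_gt_0_iff)
  ultimately show ?thesis by blast
qed

section \<open>Dimension of the span of an orbit\<close>

text \<open>Every linear form equals \<open>root_form\<close> of a suitable vector exactly, so the
  two orbits agree as sets and no scalars have to be tracked.\<close>

lemma sym_orbit_eq_root_orbit:
  assumes "linear_factorization \<mu> L f"
  obtains p where "distinct_points (length \<mu>) p" "sym_orbit \<mu> L = root_orbit p \<mu>"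
proof -
  have "\<forall>j<length \<mu>. \<exists>q. q \<noteq> (0, 0) \<and> L j = root_form q"
    using assms by (auto simp: linear_factorization_def linear_form_iff)
  then obtain p where p: "\<And>j. j < length \<mu> \<Longrightarrow> p j \<noteq> (0, 0) \<and> L j = root_form (p j)" by metis
  have "inj_on (\<lambda>j. cp1_point (p j)) {..<length \<mu>}"
  proof (rule inj_onI, rule ccontr)
    fix j k assume jk: "j \<in> {..<length \<mu>}" "k \<in> {..<length \<mu>}" "cp1_point (p j) = cp1_point (p k)" "j \<noteq> k"
    then have "proportional (L j) (L k)" using p proportional_root_form_iff by auto
    then show False using assms jk by (auto simp: linear_factorization_def)
  qed
  then have "distinct_points (length \<mu>) p" using p by (auto simp: distinct_points_def)
  moreover have "sym_orbit \<mu> L = sym_orbit \<mu> (\<lambda>j. root_form (p j))"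
  proof -
    have *: "(\<Prod>j<length \<mu>. L (\<sigma> j) ^ (\<mu> ! j)) = (\<Prod>j<length \<mu>. root_form (p (\<sigma> j)) ^ (\<mu> ! j))"
      if "\<sigma> permutes {..<length \<mu>}" for \<sigma>
      using p permutes_in_image[OF that] by (intro prod.cong) auto
    then show ?thesis unfolding sym_orbit_def by (intro Collect_cong ex_cong1) (auto simp: *)
  qed
  ultimately show ?thesis using that sym_orbit_root_form by metis
qed

text \<open>The orbit has precisely this many elements, so its span reaches this dimension exactly
  when no element is redundant.\<close>

lemma dim_root_orbit_iff:
  assumes "distinct_points (length \<mu>) p"
  shows "form_space.dim (form_space.span (root_orbit p \<mu>)) = card (permutations_of_multiset (mset \<mu>)) \<longleftrightarrow>
    form_space.independent (root_orbit p \<mu>)"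
proof
  assume "form_space.independent (root_orbit p \<mu>)"
  then show "form_space.dim (form_space.span (root_orbit p \<mu>)) = card (permutations_of_multiset (mset \<mu>))"
    using card_root_orbit[OF assms] by (simp add: form_space.dim_eq_card_independent)
next
  assume dim: "form_space.dim (form_space.span (root_orbit p \<mu>)) = card (permutations_of_multiset (mset \<mu>))"
  show "form_space.independent (root_orbit p \<mu>)"
  proof
    assume "form_space.dependent (root_orbit p \<mu>)"
    then obtain b where b: "b \<in> root_orbit p \<mu>" "b \<in> form_space.span (root_orbit p \<mu> - {b})"
      by (auto simp: form_space.dependent_def)
    have "root_orbit p \<mu> \<subseteq> form_space.span (root_orbit p \<mu> - {b})"
    proof
      fix x assume "x \<in> root_orbit p \<mu>"
      then show "x \<in> form_space.span (root_orbit p \<mu> - {b})"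
        using b(2) by (cases "x = b") (auto intro: form_space.span_base)
    qed
    then have "form_space.dim (root_orbit p \<mu>) \<le> card (root_orbit p \<mu> - {b})"
      by (rule form_space.dim_le_card) simp
    also have "\<dots> < card (root_orbit p \<mu>)" using b(1) by (intro card_Diff1_less) auto
    finally show False using dim card_root_orbit[OF assms] by simp
  qed
qed

theorem proposition2:
  fixes \<mu> :: "nat list" and d s :: nat and i m :: "nat \<Rightarrow> nat"
  assumes "d > 0" and "is_partition d \<mu>"
    and "inj_on i {1..s}" and "set \<mu> = i ` {1..s}"
    and "\<And>j. j \<in> {1..s} \<Longrightarrow> m j = count_list \<mu> (i j)"
  shows "(stabilising_index \<mu> \<longleftrightarrow> (\<exists>n F. n > 0 \<and> common_radical_solution \<mu> n F)) \<and>
    (growing_index \<mu> \<longleftrightarrow>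
       (\<forall>f \<in> S_forms \<mu>. \<forall>L. linear_factorization \<mu> L f \<longrightarrow>
          form_space.dim (form_space.span (sym_orbit \<mu> L)) =
            fact (length \<mu>) div (\<Prod>j=1..s. fact (m j))))"
proof -
  have pos: "\<forall>k\<in>set \<mu>. k \<ge> 1" and ne: "\<mu> \<noteq> []"
    using assms(1,2) by (auto simp: is_partition_def)
  \<comment> \<open>The condition to which both statements are reduced.\<close>
  let ?dep = "\<exists>p. distinct_points (length \<mu>) p \<and> form_space.dependent (root_orbit p \<mu>)"
  have a: "(\<exists>n F. n > 0 \<and> common_radical_solution \<mu> n F) \<longleftrightarrow> ?dep"
    using dependent_orbit_of_common_radical_solution[OF pos]
      common_radical_solution_of_dependent_orbit[OF pos] by blast
  have "(\<Prod>j=1..s. fact (m j)) = (\<Prod>j=1..s. fact (count_list \<mu> (i j)) :: nat)"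
    using assms(5) by (intro prod.cong) auto
  also have "\<dots> = (\<Prod>x\<in>set \<mu>. fact (count_list \<mu> x))"
    unfolding assms(4) by (subst prod.reindex[OF assms(3)]) simp
  \<comment> \<open>Reindexing by the distinct parts turns the denominator into the product over
    \<open>set \<mu>\<close> that occurs in the count of multiset permutations.\<close>
  finally have card: "card (permutations_of_multiset (mset \<mu>)) = fact (length \<mu>) div (\<Prod>j=1..s. fact (m j))"
    by (simp add: card_permutations_of_multiset(1) count_mset)
  have "(\<forall>f \<in> S_forms \<mu>. \<forall>L. linear_factorization \<mu> L f \<longrightarrow>
          form_space.dim (form_space.span (sym_orbit \<mu> L)) =
            fact (length \<mu>) div (\<Prod>j=1..s. fact (m j))) \<longleftrightarrow> \<not> ?dep" (is "?dims \<longleftrightarrow> _")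
  proof
    assume dims: ?dims
    \<comment> \<open>Every configuration of distinct points is realised by a form of the stratum,
      namely \<open>root_prod p \<mu>\<close>, so the dimension hypothesis covers all of
      them.\<close>
    have "form_space.independent (root_orbit p \<mu>)" if p: "distinct_points (length \<mu>) p" for p
    proof -
      have "root_prod p \<mu> \<in> S_forms \<mu>"
        unfolding S_forms_iff[OF pos] using p by (metis form_space.scale_one zero_neq_one)
      moreover have "linear_factorization \<mu> (\<lambda>j. root_form (p j)) (root_prod p \<mu>)"
        using p by (auto simp: linear_factorization_def root_prod_def distinct_points_def
            linear_form_root_form proportional_root_form_iff inj_on_def)
      ultimately show ?thesis
        using dims dim_root_orbit_iff[OF p] card sym_orbit_root_form by metis
    qed
    then show "\<not> ?dep" by blast
  next
    assume "\<not> ?dep"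
    then show ?dims using dim_root_orbit_iff card sym_orbit_eq_root_orbit by metis
  qed
  then show ?thesis
    using a stabilising_index_iff[OF pos ne] by (auto simp: stabilising_index_def)
qed

end
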